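(* Let $\lambda > 0$ and let $X = \{X_i\}_{i \ge 1}$ be a homogeneous Poisson point process with intensity $\lambda$ on $[0,\infty)$, with points indexed in increasing order. Suppose that $w \ge 1$. Let $E_0 := \{|G(X \cap [0,w])| = 0\}$ be the event that the Gilbert graph on $X \cap [0,w]$ has no edges. Define recursively $X_1^* := X_1$ and, for $m \ge 1$, $$X_{m+1}^* := \inf\{X_i \in X : X_i \ge X_m^* + 1\}.$$ Let $I_* := \sup\{i \ge 1 : X_i^* \le w\}$ and $X_* := X_{I_*}^*$, where, if $X_1 > w$, one sets $I_* := 0$ and $X_* := w$. Let $\mathcal F^* := \sigma(X_1^*, X_2^*, \dots)$. Then $$\mathbb P(E_0 \mid \mathcal F^* ) = e^{-\lambda\left((I_* - 1)_+ + (w - X_* ) \wedge 1\right)} \quad \text{almost surely}.$$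
   Context: The points of $X$ are ordered so that $X_i \le X_j$ whenever $i \le j$; in particular $X_1$ is the left-most point. For a locally finite point set $\varphi \subset \mathbb R$, the Gilbert graph $G(\varphi)$ has the points of $\varphi$ as nodes, with an edge between two distinct points $x, y \in \varphi$ if $|x - y| \le 1$. The graph $G(\varphi)$ is identified with its edge set, so $|G(\varphi)|$ is the number of edges. $\sigma(X_1^*, X_2^*, \dots)$ is the $\sigma$-algebra generated by the random variables $X_i^*$, $i \ge 1$. Notation: $x_+ = \max(x,0)$ and $x \wedge y = \min(x,y)$; the exponent is $-\lambda$ times the sum of $(I_*-1)_+$ and $\min(w - X_*, 1)$. *)

theory Defs
  imports "HOL-Probability.Probability"
begin

text \<open>
  Point sequences and processes are indexed from 1; the value at index 0 is never used.
\<close>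

definition point_set :: "(nat \<Rightarrow> real) \<Rightarrow> real set" where
  "point_set x = {x i | i. i \<ge> 1}"

definition num_points :: "(nat \<Rightarrow> 'a \<Rightarrow> real) \<Rightarrow> real set \<Rightarrow> 'a \<Rightarrow> nat" where
  "num_points X A \<omega> = card {i. i \<ge> 1 \<and> X i \<omega> \<in> A}"

text \<open>
  Every realization is a nondecreasing, locally finite sequence of points in \<open>[0,\<infinity>)\<close>.
  Points are counted with multiplicity; that the points are almost surely distinct is a
  consequence of the Poisson counts. The Poisson probabilities are written out because the
  library's \<open>poisson_pmf\<close> is unspecified at parameter 0, whereas the formula below
  gives the point mass at 0 for Lebesgue null sets.
\<close>

definition homogeneous_poisson_process ::
  "'a measure \<Rightarrow> real \<Rightarrow> (nat \<Rightarrow> 'a \<Rightarrow> real) \<Rightarrow> bool" where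
  "homogeneous_poisson_process M lam X \<longleftrightarrow>
     (\<forall>i\<ge>1. X i \<in> borel_measurable M) \<and>
     (\<forall>\<omega>\<in>space M. \<forall>i\<ge>1. 0 \<le> X i \<omega>) \<and>
     (\<forall>\<omega>\<in>space M. \<forall>i\<ge>1. \<forall>j\<ge>i. X i \<omega> \<le> X j \<omega>) \<and>
     (\<forall>\<omega>\<in>space M. \<forall>t. finite {i. i \<ge> 1 \<and> X i \<omega> \<le> t}) \<and>
     (\<forall>A\<in>sets borel. bounded A \<longrightarrow> A \<subseteq> {0..} \<longrightarrow>
        (\<forall>k. measure M {\<omega>\<in>space M. num_points X A \<omega> = k} =
             (lam * measure lborel A) ^ k / fact k * exp (- (lam * measure lborel A)))) \<and>
     (\<forall>\<A>. finite \<A> \<longrightarrow> (\<forall>A\<in>\<A>. A \<in> sets borel \<and> bounded A \<and> A \<subseteq> {0..}) \<longrightarrow> disjoint \<A> \<longrightarrow>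
        prob_space.indep_vars M (\<lambda>_. count_space UNIV) (num_points X) \<A>)"

definition gilbert_graph :: "real set \<Rightarrow> real set set" where
  "gilbert_graph P = {{x, y} | x y. x \<in> P \<and> y \<in> P \<and> x \<noteq> y \<and> \<bar>x - y\<bar> \<le> 1}"

definition no_edge_event :: "'a measure \<Rightarrow> (nat \<Rightarrow> 'a \<Rightarrow> real) \<Rightarrow> real \<Rightarrow> 'a set" where
  "no_edge_event M X w =
     {\<omega>\<in>space M. card (gilbert_graph (point_set (\<lambda>i. X i \<omega>) \<inter> {0..w})) = 0}"

fun star_point :: "(nat \<Rightarrow> real) \<Rightarrow> nat \<Rightarrow> real" where
  "star_point x 0 = 0"
| "star_point x (Suc 0) = x 1"
| "star_point x (Suc (Suc m)) = Inf {y \<in> point_set x. y \<ge> star_point x (Suc m) + 1}"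

definition star_index :: "(nat \<Rightarrow> real) \<Rightarrow> real \<Rightarrow> nat" where
  "star_index x w = (if x 1 > w then 0 else Sup {i. i \<ge> 1 \<and> star_point x i \<le> w})"

definition star_last :: "(nat \<Rightarrow> real) \<Rightarrow> real \<Rightarrow> real" where
  "star_last x w = (if x 1 > w then w else star_point x (star_index x w))"

definition star_algebra :: "'a measure \<Rightarrow> (nat \<Rightarrow> 'a \<Rightarrow> real) \<Rightarrow> 'a measure" where
  "star_algebra M X = sigma (space M)
     {(\<lambda>\<omega>. star_point (\<lambda>j. X j \<omega>) i) -` B \<inter> space M | i B. i \<ge> 1 \<and> B \<in> sets borel}"

end

theory Submission
  imports Defs
begin

text \<open>
  Write \<open>s\<^sub>0 < s\<^sub>1 < \<dots>\<close> for the star points. Up to a null set, the event \<open>E\<^sub>0\<close> says that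
  each gap \<open>(s\<^sub>m, s\<^sub>m + 1)\<close>, cut off at \<open>w\<close>, contains no point: a point that is not a star point
  always lies less than 1 to the right of some star point, and an edge between two consecutive star
  points needs two points at distance exactly 1, which almost surely do not exist. The star
  points are found by looking at the process outside the gaps only, so, given the star points, the
  gaps are empty with probability \<open>exp (- lam * (total length of the gaps up to w))\<close>. Since
  \<open>s\<^sub>m \<ge> m\<close>, only the first \<open>n\<close> gaps matter as soon as \<open>n > w\<close>, and their total length is the
  bracket in the exponent of the theorem (\<open>exponent_eq_gap_length_sum\<close>).

  The independence used here is that of a Poisson process along a random set, and it is made precise
  by discretization, which takes the place of the strong Markov property. Cut \<open>[0,\<infinity>)\<close> into cells of
  width \<open>1/N\<close>. The cells are occupied independently of each other, each being empty with probability
  \<open>q = exp (- lam / N)\<close>. The discrete star points \<open>K\<^sub>0, K\<^sub>1, \<dots>\<close> are obtained by jumping to the first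
  occupied cell, and from cell \<open>K\<^sub>m\<close> to the first occupied cell from \<open>K\<^sub>m + N\<close> on. For given numbers
  \<open>k\<^sub>0, \<dots>, k\<^sub>n\<^sub>-\<^sub>1\<close> the event that \<open>K\<^sub>m = k\<^sub>m\<close> for all \<open>m < n\<close> prescribes the state of finitely many cells,
  none of them strictly between \<open>k\<^sub>m\<close> and \<open>k\<^sub>m + N\<close>. Emptiness of those cells in between is
  therefore independent of it, and has probability \<open>q\<close> to the power of their number
  (\<open>prob_greedy_cells_and_empty_gaps\<close>). This is an exact discrete version of the theorem.

  As \<open>N\<close> tends to infinity, the discrete star points, divided by \<open>N\<close>, converge to the star points on
  every path, by local finiteness alone, and the discrete gap events stabilize. Dominated
  convergence yields the defining identity of the conditional expectation on cylinders
  \<open>s\<^sub>0 < t\<^sub>0, \<dots>, s\<^sub>n\<^sub>-\<^sub>1 < t\<^sub>n\<^sub>-\<^sub>1\<close> with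
  \<open>n > w\<close> (\<open>integral_cylinder_no_edge\<close>). These cylinders are closed under intersection
  and generate the star algebra, so the identity extends to the whole star algebra
  (\<open>set_integral_no_edge\<close>).
\<close>

section \<open>Star points of a locally finite set and their discretization\<close>

definition next_point :: "real set \<Rightarrow> real \<Rightarrow> real" where
  "next_point P t = Inf {y \<in> P. t \<le> y}"

text \<open>
  The star points depend only on the set of points. Counting them from 0 and starting the
  search for the first one at 0 makes them all instances of one search.
\<close>

primrec greedy_point :: "real set \<Rightarrow> nat \<Rightarrow> real" where
  "greedy_point P 0 = next_point P 0"
| "greedy_point P (Suc m) = next_point P (greedy_point P m + 1)"

text \<open>
  Cell \<open>j\<close> at mesh \<open>1/N\<close> is \<open>[j/N, (j+1)/N)\<close>.
\<close>

definition occupied_cells :: "nat \<Rightarrow> real set \<Rightarrow> nat set" where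
  "occupied_cells N P = (\<lambda>p. nat \<lfloor>real N * p\<rfloor>) ` P"

text \<open>
  The discrete star points. The search resumes at the cell with index \<open>N\<close> beyond
  the last one found, although this cell may contain points at distance less than 1: starting
  there shifts the search by exactly 1 and makes the limit hold on every path, even when two
  points are exactly 1 apart.
\<close>

primrec greedy_cell :: "nat \<Rightarrow> nat set \<Rightarrow> nat \<Rightarrow> nat" where
  "greedy_cell N U 0 = (LEAST j. j \<in> U)"
| "greedy_cell N U (Suc m) = (LEAST j. j \<in> U \<and> greedy_cell N U m + N \<le> j)"

definition cell_gap :: "nat \<Rightarrow> real \<Rightarrow> nat \<Rightarrow> nat set" where
  "cell_gap N w k = {j. k < j \<and> j < k + N \<and> real j \<le> w * real N}"

text \<open>
  The length of the part of \<open>(s, s + 1)\<close> to the left of \<open>w\<close>.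
\<close>

definition gap_length :: "real \<Rightarrow> real \<Rightarrow> real" where
  "gap_length w s = max 0 (min 1 (w - s))"

lemma floor_ratio_tendsto:
  assumes "0 \<le> (s::real)"
  shows "(\<lambda>N. real (nat \<lfloor>real N * s\<rfloor>) / real N) \<longlonglongrightarrow> s"
proof (rule tendsto_sandwich)
  show "\<forall>\<^sub>F N in sequentially. s - 1 / real N \<le> real (nat \<lfloor>real N * s\<rfloor>) / real N"
    using eventually_gt_at_top[of 0]
  proof eventually_elim
    case (elim N)
    have "real N * s - 1 \<le> real (nat \<lfloor>real N * s\<rfloor>)" by linarith
    then have "(real N * s - 1) / real N \<le> real (nat \<lfloor>real N * s\<rfloor>) / real N"
      using elim by (intro divide_right_mono) auto
    then show ?case using elim by (simp add: diff_divide_distrib)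
  qed
  show "\<forall>\<^sub>F N in sequentially. real (nat \<lfloor>real N * s\<rfloor>) / real N \<le> s"
    using eventually_gt_at_top[of 0]
  proof eventually_elim
    case (elim N)
    then have "real (nat \<lfloor>real N * s\<rfloor>) \<le> s * real N" using assms by (simp add: mult.commute)
    then show ?case using elim by (simp add: divide_le_eq)
  qed
  show "(\<lambda>N. s - 1 / real N) \<longlonglongrightarrow> s"
    using tendsto_diff[OF tendsto_const lim_const_over_n[of 1]] by simp
qed simp

locale point_configuration =
  fixes P :: "real set"
  assumes nonneg: "p \<in> P \<Longrightarrow> 0 \<le> p"
    and locally_finite: "finite (P \<inter> {..t})"
    and unbounded: "\<exists>p\<in>P. t \<le> p"
begin

lemma next_point_least:
  "next_point P t \<in> P" "t \<le> next_point P t"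
  "\<And>p. p \<in> P \<Longrightarrow> t \<le> p \<Longrightarrow> next_point P t \<le> p"
proof -
  obtain q where q: "q \<in> P" "t \<le> q" using unbounded by blast
  define F where "F = {y \<in> P. t \<le> y} \<inter> {..q}"
  have F: "finite F" "F \<noteq> {}"
    using q locally_finite[of q] by (auto simp: F_def intro: finite_subset[of _ "P \<inter> {..q}"])
  have min: "Min F \<le> y" if "y \<in> P" "t \<le> y" for y
  proof (cases "y \<le> q")
    case True then show ?thesis using F that by (auto simp: F_def)
  next
    case False
    have "Min F \<le> q" using F q by (auto simp: F_def)
    then show ?thesis using False by linarith
  qed
  have inF: "Min F \<in> F" using F by simp
  have "next_point P t = Min F"
    unfolding next_point_def by (rule cInf_eq_minimum) (use inF min in \<open>auto simp: F_def\<close>)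
  then show "next_point P t \<in> P" "t \<le> next_point P t"
    "\<And>p. p \<in> P \<Longrightarrow> t \<le> p \<Longrightarrow> next_point P t \<le> p"
    using inF min by (auto simp: F_def)
qed

lemma greedy_point_in: "greedy_point P m \<in> P"
  by (cases m) (auto intro: next_point_least)

lemma greedy_point_Suc: "greedy_point P m + 1 \<le> greedy_point P (Suc m)"
  by (auto intro: next_point_least)

lemma greedy_point_mono: "m \<le> m' \<Longrightarrow> greedy_point P m + real (m' - m) \<le> greedy_point P m'"
proof (induction m' rule: dec_induct)
  case (step l)
  then show ?case using greedy_point_Suc[of l] by (simp del: greedy_point.simps add: of_nat_diff)
qed simp

lemma greedy_point_ge: "real m \<le> greedy_point P m"
  using greedy_point_mono[of 0 m] nonneg[OF greedy_point_in[of 0]] by (simp del: greedy_point.simps)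

text \<open>
  Isolation of points from any position \<open>a\<close> is the form in which local finiteness
  enters the limits.
\<close>

lemma isolated:
  obtains e where "e > 0" "\<And>p. p \<in> P \<Longrightarrow> p \<noteq> a \<Longrightarrow> e \<le> \<bar>p - a\<bar>"
proof -
  obtain d where d: "d > 0" "\<forall>x\<in>P \<inter> {..a + 1}. x \<noteq> a \<longrightarrow> d \<le> dist a x"
    using finite_set_avoid[OF locally_finite] by blast
  show ?thesis
  proof (rule that[of "min d 1"])
    fix p assume "p \<in> P" "p \<noteq> a"
    with d show "min d 1 \<le> \<bar>p - a\<bar>" 
      by (cases "p \<le> a + 1") (auto simp: dist_real_def abs_minus_commute)
  qed (use d in auto)
qed

lemma occupied_cells_unbounded:
  assumes "N > 0" shows "\<exists>j\<in>occupied_cells N P. k \<le> j"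
proof -
  obtain p where p: "p \<in> P" "real k / real N \<le> p" using unbounded by blast
  then have "real k \<le> real N * p" using assms by (simp add: field_simps)
  then have "k \<le> nat \<lfloor>real N * p\<rfloor>" by (simp add: le_nat_floor)
  then show ?thesis using p by (auto simp: occupied_cells_def)
qed

text \<open>
  A cell that is found too early contains a point just below the position
  \<open>s\<^sub>m + 1\<close>, at distance less than \<open>1/N\<close>. For large
  \<open>N\<close> local finiteness excludes such points.
\<close>

lemma eventually_greedy_cell:
  "\<forall>\<^sub>F N in sequentially.
     greedy_cell N (occupied_cells N P) m = nat \<lfloor>real N * greedy_point P m\<rfloor>"
proof (induction m)
  case 0
  have "greedy_cell N (occupied_cells N P) 0 = nat \<lfloor>real N * greedy_point P 0\<rfloor>" for N
    unfolding greedy_cell.simps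
  proof (rule Least_equality)
    show "nat \<lfloor>real N * greedy_point P 0\<rfloor> \<in> occupied_cells N P"
      using greedy_point_in by (auto simp: occupied_cells_def simp del: greedy_point.simps)
  next
    fix j assume "j \<in> occupied_cells N P"
    then obtain p where "p \<in> P" "j = nat \<lfloor>real N * p\<rfloor>" by (auto simp: occupied_cells_def)
    then show "nat \<lfloor>real N * greedy_point P 0\<rfloor> \<le> j"
      using next_point_least(3)[of p 0] nonneg by (auto intro!: nat_mono floor_mono mult_left_mono)
  qed
  then show ?case by simp
next
  case (Suc m)
  let ?s = "greedy_point P m" and ?s' = "greedy_point P (Suc m)"
  obtain e where e: "e > 0" "\<And>p. p \<in> P \<Longrightarrow> p \<noteq> ?s + 1 \<Longrightarrow> e \<le> \<bar>p - (?s + 1)\<bar>"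
    by (rule isolated[of "?s + 1"]) blast
  have "\<forall>\<^sub>F N in sequentially. N > 0 \<and> 1 / e < real N"
    using eventually_gt_at_top[of 0] filterlim_real_sequentially
    by (auto simp: filterlim_at_top_dense intro: eventually_conj)
  with Suc show ?case
  proof eventually_elim
    case (elim N)
    have s0: "0 \<le> ?s" using nonneg greedy_point_in by blast
    have shift: "greedy_cell N (occupied_cells N P) m + N = nat \<lfloor>real N * (?s + 1)\<rfloor>"
      using elim s0 by (simp add: algebra_simps nat_add_distrib)
    show ?case unfolding greedy_cell.simps shift
    proof (rule Least_equality, intro conjI)
      show "nat \<lfloor>real N * ?s'\<rfloor> \<in> occupied_cells N P"
        using greedy_point_in by (auto simp: occupied_cells_def simp del: greedy_point.simps)
      show "nat \<lfloor>real N * (?s + 1)\<rfloor> \<le> nat \<lfloor>real N * ?s'\<rfloor>"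
        by (intro nat_mono floor_mono mult_left_mono greedy_point_Suc) simp
    next
      fix j assume j: "j \<in> occupied_cells N P \<and> nat \<lfloor>real N * (?s + 1)\<rfloor> \<le> j"
      then obtain p where p: "p \<in> P" "j = nat \<lfloor>real N * p\<rfloor>" by (auto simp: occupied_cells_def)
      have p0: "0 \<le> p" using nonneg p by blast
      have "\<lfloor>real N * (?s + 1)\<rfloor> \<le> \<lfloor>real N * p\<rfloor>" using j p p0 s0 by (simp add: nat_le_iff)
      then have "real N * (?s + 1) < real N * p + 1" by linarith
      then have "?s + 1 - p < 1 / real N" using elim by (simp add: field_simps)
      also have "1 / real N < e" using elim e(1) by (simp add: field_simps)
      finally have "?s + 1 \<le> p" using e(2)[OF p(1)] by (cases "p = ?s + 1") linarith+
      then have "?s' \<le> p" using p(1) by (auto intro: next_point_least)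
      then show "nat \<lfloor>real N * ?s'\<rfloor> \<le> j"
        unfolding p(2) by (intro nat_mono floor_mono mult_left_mono) auto
    qed
  qed
qed

lemma greedy_cell_tendsto:
  "(\<lambda>N. real (greedy_cell N (occupied_cells N P) m) / real N) \<longlonglongrightarrow> greedy_point P m"
proof (rule Lim_transform_eventually)
  show "(\<lambda>N. real (nat \<lfloor>real N * greedy_point P m\<rfloor>) / real N) \<longlonglongrightarrow> greedy_point P m"
    using nonneg greedy_point_in by (blast intro: floor_ratio_tendsto)
  show "\<forall>\<^sub>F N in sequentially. real (nat \<lfloor>real N * greedy_point P m\<rfloor>) / real N =
          real (greedy_cell N (occupied_cells N P) m) / real N"
    using eventually_greedy_cell[of m] by eventually_elim simp
qed

text \<open>
  The right end of the cell found is used for the comparison with \<open>t\<close>: it lies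
  strictly to the right of the star point and converges to it, so strict upper bounds are
  decided correctly even in the boundary case \<open>s\<^sub>m = t\<close>.
\<close>

lemma eventually_cell_less_iff:
  "\<forall>\<^sub>F N in sequentially.
     real (greedy_cell N (occupied_cells N P) m) + 1 < t * real N \<longleftrightarrow> greedy_point P m < t"
proof (cases "greedy_point P m < t")
  case True
  have "(\<lambda>N. real (greedy_cell N (occupied_cells N P) m) / real N + 1 / real N) \<longlonglongrightarrow> greedy_point P m + 0"
    by (intro tendsto_add greedy_cell_tendsto lim_const_over_n)
  then have "\<forall>\<^sub>F N in sequentially. real (greedy_cell N (occupied_cells N P) m) / real N + 1 / real N < t"
    by (rule order_tendstoD(2)) (use True in auto)
  with eventually_gt_at_top[of 0] show ?thesis
  proof eventually_elim
    case (elim N)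
    then have "(real (greedy_cell N (occupied_cells N P) m) + 1) / real N < t"
      by (simp add: add_divide_distrib)
    then show ?case using True elim by (simp add: divide_less_eq)
  qed
next
  case False
  show ?thesis using eventually_greedy_cell[of m]
  proof eventually_elim
    case (elim N)
    have "real N * t \<le> real N * greedy_point P m" using False by (intro mult_left_mono) auto
    also have "\<dots> < real (nat \<lfloor>real N * greedy_point P m\<rfloor>) + 1" by linarith
    finally show ?case using elim False by (simp add: mult.commute)
  qed
qed

text \<open>
  The cells of the gap are contained in \<open>(s\<^sub>m, s\<^sub>m + 1)\<close> and exhaust
  it as \<open>N\<close> grows. At the cut-off the cells may reach beyond \<open>w\<close> by
  at most \<open>1/N\<close>, which is harmless because the points to the right of
  \<open>w\<close> keep a positive distance from it.
\<close>

lemma eventually_cell_gap_iff: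
  "\<forall>\<^sub>F N in sequentially.
     cell_gap N w (greedy_cell N (occupied_cells N P) m) \<inter> occupied_cells N P = {} \<longleftrightarrow>
     P \<inter> {greedy_point P m<..<greedy_point P m + 1} \<inter> {..w} = {}"
proof -
  let ?s = "greedy_point P m"
  have s0: "0 \<le> ?s" using nonneg greedy_point_in by blast
  have cell_iff: "nat \<lfloor>real N * p\<rfloor> \<in> cell_gap N w (nat \<lfloor>real N * ?s\<rfloor>) \<longleftrightarrow>
       \<lfloor>real N * ?s\<rfloor> < \<lfloor>real N * p\<rfloor> \<and> \<lfloor>real N * p\<rfloor> < \<lfloor>real N * (?s + 1)\<rfloor> \<and>
       \<lfloor>real N * p\<rfloor> \<le> w * real N" if "0 \<le> p" for N p
  proof -
    have ge: "0 \<le> \<lfloor>real N * p\<rfloor>" "0 \<le> \<lfloor>real N * ?s\<rfloor>" using s0 that by auto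
    have "\<lfloor>real N * (?s + 1)\<rfloor> = \<lfloor>real N * ?s\<rfloor> + int N" by (simp add: algebra_simps)
    then show ?thesis using ge unfolding cell_gap_def mem_Collect_eq by linarith
  qed
  show ?thesis
  proof (cases "P \<inter> {?s<..<?s + 1} \<inter> {..w} = {}")
    case True
    obtain e where e: "e > 0" "\<And>p. p \<in> P \<Longrightarrow> p \<noteq> w \<Longrightarrow> e \<le> \<bar>p - w\<bar>"
      by (rule isolated[of w]) blast
    have "\<forall>\<^sub>F N in sequentially. N > 0 \<and> 1 / e < real N"
      using eventually_gt_at_top[of 0] filterlim_real_sequentially
      by (auto simp: filterlim_at_top_dense intro: eventually_conj)
    with eventually_greedy_cell[of m] show ?thesis
    proof eventually_elim
      case (elim N)
      have "False" if p: "p \<in> P" "nat \<lfloor>real N * p\<rfloor> \<in> cell_gap N w (nat \<lfloor>real N * ?s\<rfloor>)" for p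
      proof -
        from p have *: "\<lfloor>real N * ?s\<rfloor> < \<lfloor>real N * p\<rfloor>" "\<lfloor>real N * p\<rfloor> < \<lfloor>real N * (?s + 1)\<rfloor>"
          "\<lfloor>real N * p\<rfloor> \<le> w * real N" using cell_iff nonneg by auto
        then have "?s < p" "p < ?s + 1"
          using floor_mono[OF mult_left_mono, of p ?s "real N"]
            floor_mono[OF mult_left_mono, of "?s + 1" p "real N"] by linarith+
        moreover have "p \<le> w"
        proof -
          have "real N * p < w * real N + 1" using *(3) by linarith
          then have "p - w < 1 / real N" using elim by (simp add: field_simps)
          also have "1 / real N < e" using elim e(1) by (simp add: field_simps)
          finally show ?thesis using e(2)[OF p(1)] by (cases "p = w") linarith+
        qed
        ultimately show False using True p by auto
      qed
      then show ?case using True elim by (auto simp: occupied_cells_def)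
    qed
  next
    case False
    then obtain p where p: "p \<in> P" "?s < p" "p < ?s + 1" "p \<le> w" by auto
    have "\<forall>\<^sub>F N in sequentially. 1 / (p - ?s) < real N \<and> 1 / (?s + 1 - p) < real N"
      using filterlim_real_sequentially
      by (auto simp: filterlim_at_top_dense intro: eventually_conj)
    with eventually_greedy_cell[of m] show ?thesis
    proof eventually_elim
      case (elim N)
      have "real N * ?s + 1 < real N * p" "real N * p + 1 < real N * (?s + 1)"
        using elim p by (simp_all add: field_simps)
      moreover have "real N * p \<le> w * real N"
        using p(4) by (simp add: mult.commute[of "real N"] mult_right_mono)
      ultimately have "\<lfloor>real N * ?s\<rfloor> < \<lfloor>real N * p\<rfloor>" "\<lfloor>real N * p\<rfloor> < \<lfloor>real N * (?s + 1)\<rfloor>"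
        "\<lfloor>real N * p\<rfloor> \<le> w * real N" by linarith+
      then have "nat \<lfloor>real N * p\<rfloor> \<in> cell_gap N w (nat \<lfloor>real N * ?s\<rfloor>)"
        using cell_iff nonneg p by blast
      then show ?case using False elim p by (auto simp: occupied_cells_def)
    qed
  qed
qed

lemma card_cell_gap_tendsto:
  assumes "0 \<le> w"
  shows "(\<lambda>N. real (card (cell_gap N w (greedy_cell N (occupied_cells N P) m))) / real N)
           \<longlonglongrightarrow> gap_length w (greedy_point P m)"
proof -
  let ?K = "\<lambda>N. greedy_cell N (occupied_cells N P) m"
  have "(\<lambda>N. max 0 (min (1 - 1 / real N) (real (nat \<lfloor>real N * w\<rfloor>) / real N - real (?K N) / real N)))
     \<longlonglongrightarrow> max 0 (min (1 - 0) (w - greedy_point P m))"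
    by (intro tendsto_intros lim_const_over_n greedy_cell_tendsto floor_ratio_tendsto assms)
  moreover have "\<forall>\<^sub>F N in sequentially.
      max 0 (min (1 - 1 / real N) (real (nat \<lfloor>real N * w\<rfloor>) / real N - real (?K N) / real N)) =
      real (card (cell_gap N w (?K N))) / real N"
    using eventually_gt_at_top[of 0]
  proof eventually_elim
    case (elim N)
    let ?L = "nat \<lfloor>real N * w\<rfloor>"
    have div: "max 0 (min a b) / c = max 0 (min (a / c) (b / c))" if "0 < c" for a b c :: real
      using that by (auto simp: min_def max_def divide_le_cancel zero_le_divide_iff)
    have le: "real j \<le> w * real N \<longleftrightarrow> j \<le> ?L" for j
      using assms by (simp add: le_nat_iff le_floor_iff mult.commute)
    have "cell_gap N w (?K N) = {?K N<..min (?K N + N - 1) ?L}"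
      using elim by (auto simp: cell_gap_def le)
    then have "card (cell_gap N w (?K N)) = min (?K N + N - 1) ?L - ?K N" by simp
    then have "real (card (cell_gap N w (?K N))) = max 0 (min (real N - 1) (real ?L - real (?K N)))"
    proof -
      have diff: "real (a - b) = max 0 (real a - real b)" for a b :: nat by linarith
      have "real (min (?K N + N - 1) ?L) = min (real (?K N) + real N - 1) (real ?L)"
        using elim by (simp add: of_nat_min of_nat_diff)
      then show ?thesis unfolding \<open>card _ = _\<close> diff by (simp only: min_diff_distrib_left) simp
    qed
    also have "\<dots> / real N = max 0 (min (1 - 1 / real N) (real ?L / real N - real (?K N) / real N))"
      using elim div[of "real N"] by (simp add: diff_divide_distrib)
    finally show ?case by simp
  qed
  ultimately show ?thesis by (simp add: gap_length_def Lim_transform_eventually)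
qed

text \<open>
  If two points of \<open>[0,w]\<close> are joined by an edge, consider the last star point
  \<open>s\<close> that is at most the smaller one. Both points cannot be star points, their
  distance being less than 1, and whichever of them is the first that differs from
  \<open>s\<close> lies in the gap behind \<open>s\<close>. The bound on \<open>n\<close>
  ensures that this gap is among those considered, because the star point with index
  \<open>m\<close> is at least \<open>m\<close>.
\<close>

lemma no_edges_iff_gaps_empty:
  assumes unit: "\<And>p. p \<in> P \<Longrightarrow> p + 1 \<notin> P" and n: "w < real n"
  shows "gilbert_graph (P \<inter> {0..w}) = {} \<longleftrightarrow>
     (\<forall>m<n. P \<inter> {greedy_point P m<..<greedy_point P m + 1} \<inter> {..w} = {})"
proof
  assume L: "gilbert_graph (P \<inter> {0..w}) = {}"
  show "\<forall>m<n. P \<inter> {greedy_point P m<..<greedy_point P m + 1} \<inter> {..w} = {}"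
  proof (intro allI impI equals0I)
    fix m p assume p: "p \<in> P \<inter> {greedy_point P m<..<greedy_point P m + 1} \<inter> {..w}"
    then have "greedy_point P m \<in> P \<inter> {0..w}" "p \<in> P \<inter> {0..w}" "greedy_point P m \<noteq> p"
      "\<bar>greedy_point P m - p\<bar> \<le> 1"
      using greedy_point_in[of m] nonneg[of p] nonneg[OF greedy_point_in[of m]] by auto
    then have "{greedy_point P m, p} \<in> gilbert_graph (P \<inter> {0..w})"
      unfolding gilbert_graph_def by blast
    then show False using L by auto
  qed
next
  assume R: "\<forall>m<n. P \<inter> {greedy_point P m<..<greedy_point P m + 1} \<inter> {..w} = {}"
  have no_pair: False if p: "p \<in> P" "p' \<in> P" "p < p'" "p' - p \<le> 1" "p' \<le> w" for p p'
  proof -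
    have lt: "p' < p + 1" using unit[of p] p by (cases "p' = p + 1") auto
    have ex: "\<exists>m. p < greedy_point P m"
    proof -
      obtain m where "p < real m" using reals_Archimedean2 by blast
      then show ?thesis using greedy_point_ge[of m] by (intro exI[of _ m]) linarith
    qed
    define l where "l = (LEAST m. p < greedy_point P m)"
    have l: "p < greedy_point P l" unfolding l_def by (rule LeastI_ex[OF ex])
    have "l \<noteq> 0" using l next_point_least(3)[of p 0] p nonneg by (intro notI) auto
    then obtain m where m: "l = Suc m" by (cases l) auto
    have ml: "greedy_point P m \<le> p" using not_less_Least[of m "\<lambda>m. p < greedy_point P m"] m
      by (auto simp: l_def not_less)
    have pl: "p < greedy_point P m + 1"
      using l next_point_least(3)[of p "greedy_point P m + 1"] p m by force
    have "m < n" using greedy_point_ge[of m] ml p n by linarith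
    with R have E: "P \<inter> {greedy_point P m<..<greedy_point P m + 1} \<inter> {..w} = {}" by blast
    show False
    proof (cases "greedy_point P m = p")
      case True
      then have "p' \<in> P \<inter> {greedy_point P m<..<greedy_point P m + 1} \<inter> {..w}" using p lt by auto
      then show False using E by blast
    next
      case False
      then have "p \<in> P \<inter> {greedy_point P m<..<greedy_point P m + 1} \<inter> {..w}" using p pl ml by auto
      then show False using E by blast
    qed
  qed
  show "gilbert_graph (P \<inter> {0..w}) = {}"
  proof (rule equals0I)
    fix e assume "e \<in> gilbert_graph (P \<inter> {0..w})"
    then obtain x y where "x \<in> P" "y \<in> P" "x \<le> w" "y \<le> w" "x \<noteq> y" "\<bar>x - y\<bar> \<le> 1"
      by (auto simp: gilbert_graph_def)
    then show False using no_pair[of x y] no_pair[of y x] by (cases "x < y") auto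
  qed
qed

lemma finite_gilbert_graph: "finite (gilbert_graph (P \<inter> {0..w}))"
proof (rule finite_subset)
  show "gilbert_graph (P \<inter> {0..w}) \<subseteq> Pow (P \<inter> {..w})" by (auto simp: gilbert_graph_def)
  show "finite (Pow (P \<inter> {..w}))" by (rule finite_Pow_iff[THEN iffD2, OF locally_finite])
qed

end

text \<open>
  Steps of size at least 1 make every gap before the last point up to \<open>w\<close> a full
  one; the gaps of later points lie beyond \<open>w\<close>.
\<close>

lemma gap_length_sum:
  fixes s :: "nat \<Rightarrow> real"
  assumes step: "\<And>m. s m + 1 \<le> s (Suc m)" and "I < n" "s I \<le> w" "w < s (Suc I)"
  shows "(\<Sum>m<n. gap_length w (s m)) = real I + min (w - s I) 1"
proof -
  have mono: "s m + real (m' - m) \<le> s m'" if "m \<le> m'" for m m'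
    using that
  proof (induction m' rule: dec_induct)
    case (step l) then show ?case using assms(1)[of l] by (simp add: of_nat_diff)
  qed simp
  have "gap_length w (s m) = (if m < I then 1 else if m = I then min (w - s I) 1 else 0)" for m
  proof -
    consider "m < I" | "m = I" | "Suc I \<le> m" by linarith
    then show ?thesis
    proof cases
      case 1
      then have "s m + 1 \<le> s I" using mono[of m I] by linarith
      then show ?thesis using 1 assms by (simp add: gap_length_def)
    next
      case 2 then show ?thesis using assms by (simp add: gap_length_def min.commute)
    next
      case 3
      then have "s (Suc I) \<le> s m" using mono[of "Suc I" m] by linarith
      then show ?thesis using 3 assms by (simp add: gap_length_def)
    qed
  qed
  then have "(\<Sum>m<n. gap_length w (s m)) =
      (\<Sum>m<n. (if m < I then 1 else 0) + (if m = I then min (w - s I) 1 else 0))"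
    by (intro sum.cong) auto
  also have "\<dots> = (\<Sum>m<n. if m < I then 1 else 0) + min (w - s I) 1"
    using assms(2) by (simp add: sum.distrib)
  also have "(\<Sum>m<n. if m < I then 1 else 0 :: real) = real I"
  proof -
    have "{..<n} \<inter> {m. m < I} = {..<I}" using assms(2) by auto
    then show ?thesis by (simp add: sum.If_cases)
  qed
  finally show ?thesis .
qed

locale point_sequence =
  fixes x :: "nat \<Rightarrow> real"
  assumes nonneg_seq: "1 \<le> i \<Longrightarrow> 0 \<le> x i"
    and mono_seq: "1 \<le> i \<Longrightarrow> i \<le> j \<Longrightarrow> x i \<le> x j"
    and finite_seq: "finite {i. 1 \<le> i \<and> x i \<le> t}"
begin

sublocale point_configuration "point_set x"
proof
  fix p assume "p \<in> point_set x" then show "0 \<le> p" using nonneg_seq by (auto simp: point_set_def)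
next
  fix t
  have "point_set x \<inter> {..t} \<subseteq> x ` {i. 1 \<le> i \<and> x i \<le> t}" by (auto simp: point_set_def)
  then show "finite (point_set x \<inter> {..t})" using finite_seq finite_surj by blast
next
  fix t
  have "\<not> {1..} \<subseteq> {i. 1 \<le> i \<and> x i \<le> t}"
    using finite_subset[OF _ finite_seq[of t]] infinite_Ici[of "1::nat"] by blast
  then obtain i where "1 \<le> i" "t < x i" by force
  then show "\<exists>p\<in>point_set x. t \<le> p" by (intro bexI[of _ "x i"]) (auto simp: point_set_def)
qed

lemma greedy_point_0: "greedy_point (point_set x) 0 = x 1"
proof -
  have in1: "x 1 \<in> point_set x" by (auto simp: point_set_def)
  have "x 1 \<le> p" if "p \<in> point_set x" for p using that mono_seq by (auto simp: point_set_def)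
  then show ?thesis unfolding greedy_point.simps
    using in1 nonneg[OF in1] by (blast intro: antisym next_point_least)
qed

lemma star_point_eq: "star_point x (Suc m) = greedy_point (point_set x) m"
proof (induction m)
  case 0 then show ?case using greedy_point_0 by simp
next
  case (Suc m) then show ?case by (simp add: next_point_def)
qed

text \<open>
  The right-hand side involves a fixed number of star points instead of a random one, and
  needs no case distinction for a first point beyond \<open>w\<close>. Moreover, all
  \<open>n > w\<close> give the same value.
\<close>

lemma exponent_eq_gap_length_sum:
  assumes n: "w < real n"
  shows "max (real (star_index x w) - 1) 0 + min (w - star_last x w) 1 =
     (\<Sum>m<n. gap_length w (star_point x (Suc m)))"
proof -
  let ?s = "\<lambda>m. star_point x (Suc m)"
  have step: "?s m + 1 \<le> ?s (Suc m)" for m unfolding star_point_eq by (rule greedy_point_Suc)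
  have ge: "real m \<le> ?s m" for m unfolding star_point_eq by (rule greedy_point_ge)
  show ?thesis
  proof (cases "w < x 1")
    case True
    have "gap_length w (?s m) = 0" for m
      using True greedy_point_mono[of 0 m] unfolding star_point_eq
      by (simp add: gap_length_def greedy_point_0 del: greedy_point.simps)
    then show ?thesis using True by (simp add: star_index_def star_last_def)
  next
    case False
    define S where "S = {i. 1 \<le> i \<and> star_point x i \<le> w}"
    have "S \<subseteq> {..n}"
    proof
      fix i assume "i \<in> S"
      then obtain m where "i = Suc m" "?s m \<le> w" by (cases i) (auto simp: S_def)
      then show "i \<in> {..n}" using ge[of m] n by auto
    qed
    then have fin: "finite S" using finite_subset by blast
    have "1 \<in> S" using False by (simp add: S_def)
    have Max: "Max S \<in> S" using fin \<open>1 \<in> S\<close> by (intro Max_in) auto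
    have SucMax: "Suc (Max S) \<notin> S" using Max_ge[OF fin, of "Suc (Max S)"] by auto
    obtain I where I: "Max S = Suc I" using Max by (cases "Max S") (auto simp: S_def)
    have "star_index x w = Sup S" using False by (simp add: star_index_def S_def)
    then have idx: "star_index x w = Suc I" using cSup_eq_Max[OF fin] \<open>1 \<in> S\<close> I by (metis empty_iff)
    have sI: "?s I \<le> w" "w < ?s (Suc I)" using Max SucMax I by (auto simp: S_def simp del: star_point.simps)
    have "I < n" using ge[of I] sI n by linarith
    from gap_length_sum[of ?s, OF step this sI] show ?thesis
      using False by (simp add: idx star_last_def del: star_point.simps)
  qed
qed

end

section \<open>The discrete model\<close>

text \<open>
  The cell where the search for the discrete star point with index \<open>m\<close> starts if
  those before it are given by \<open>k\<close>.
\<close>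

definition search_start :: "nat \<Rightarrow> (nat \<Rightarrow> nat) \<Rightarrow> nat \<Rightarrow> nat" where
  "search_start N k m = (case m of 0 \<Rightarrow> 0 | Suc l \<Rightarrow> k l + N)"

lemma Least_from_eq_iff:
  fixes U :: "nat set"
  assumes "\<exists>j\<in>U. b \<le> j"
  shows "(LEAST j. j \<in> U \<and> b \<le> j) = c \<longleftrightarrow> c \<in> U \<and> b \<le> c \<and> {b..<c} \<inter> U = {}"
proof
  assume c: "(LEAST j. j \<in> U \<and> b \<le> j) = c"
  have "c \<in> U \<and> b \<le> c" unfolding c[symmetric] by (rule LeastI_ex) (use assms in auto)
  moreover have "\<not> (j \<in> U \<and> b \<le> j)" if "j < c" for j using not_less_Least that c by blast
  ultimately show "c \<in> U \<and> b \<le> c \<and> {b..<c} \<inter> U = {}" by auto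
next
  assume c: "c \<in> U \<and> b \<le> c \<and> {b..<c} \<inter> U = {}"
  show "(LEAST j. j \<in> U \<and> b \<le> j) = c"
  proof (rule Least_equality)
    fix j assume "j \<in> U \<and> b \<le> j"
    then show "c \<le> j" using c by (cases "j < c") auto
  qed (use c in auto)
qed

lemma greedy_cell_eq_Least:
  "greedy_cell N U m = (LEAST j. j \<in> U \<and> search_start N (greedy_cell N U) m \<le> j)"
  by (cases m) (simp_all add: search_start_def)

lemma greedy_cells_eq_iff:
  assumes unb: "\<And>b. \<exists>j\<in>U. b \<le> j"
  shows "(\<forall>m<n. greedy_cell N U m = k m) \<longleftrightarrow>
    (\<forall>m<n. k m \<in> U \<and> search_start N k m \<le> k m \<and> {search_start N k m..<k m} \<inter> U = {})"
    (is "?L = ?R")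
proof
  assume L: ?L
  show ?R
  proof (intro allI impI)
    fix m assume m: "m < n"
    have "search_start N (greedy_cell N U) m = search_start N k m"
      using L m by (cases m) (simp_all add: search_start_def)
    then show "k m \<in> U \<and> search_start N k m \<le> k m \<and> {search_start N k m..<k m} \<inter> U = {}"
      using L m greedy_cell_eq_Least[of N U m] Least_from_eq_iff[OF unb] by metis
  qed
next
  assume R: ?R
  have "greedy_cell N U m = k m" if "m < n" for m
    using that
  proof (induction m)
    case 0
    then have "k 0 \<in> U \<and> search_start N k 0 \<le> k 0 \<and> {search_start N k 0..<k 0} \<inter> U = {}"
      using R by blast
    then show ?case using Least_from_eq_iff[OF unb, of 0 "k 0"] by (simp add: search_start_def)
  next
    case (Suc m)
    then have "k (Suc m) \<in> U \<and> search_start N k (Suc m) \<le> k (Suc m) \<and>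
        {search_start N k (Suc m)..<k (Suc m)} \<inter> U = {}"
      using R by blast
    then show ?case using Suc Least_from_eq_iff[OF unb, of "k m + N" "k (Suc m)"]
      by (simp add: search_start_def)
  qed
  then show ?L by blast
qed

lemma finite_cell_gap: "finite (cell_gap N w k)"
  by (rule finite_subset[of _ "{..<k + N}"]) (auto simp: cell_gap_def)

text \<open>
  The blocks \<open>[search start, k m + N)\<close> follow each other without overlap. Each
  consists of the cells searched in vain, the cell found, and the gap behind it.
\<close>

lemma search_blocks_disjoint:
  assumes chain: "\<And>m. m < n \<Longrightarrow> search_start N k m \<le> k m"
    and m: "m < n" "search_start N k m \<le> x" "x < k m + N"
    and m': "m' < n" "search_start N k m' \<le> x" "x < k m' + N"
  shows "m = m'"
proof -
  have le: "k l + N \<le> search_start N k l'" if "l < l'" "l' < n" for l l'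
    using that
  proof (induction l')
    case (Suc l')
    show ?case
    proof (cases "l = l'")
      case False
      then have "k l + N \<le> search_start N k l'" using Suc by auto
      also have "\<dots> \<le> k l'" using chain Suc by auto
      finally show ?thesis by (simp add: search_start_def)
    qed (simp add: search_start_def)
  qed simp
  show ?thesis using le[of m m'] le[of m' m] m m' by (cases m m' rule: linorder_cases) auto
qed

text \<open>
  Independent Bernoulli cells, with \<open>q\<close> the probability of being empty. The joint
  law is given by the probabilities of finite patterns of occupied and empty cells.
\<close>

locale bernoulli_cells = prob_space M for M :: "'a measure" +
  fixes U :: "'a \<Rightarrow> nat set" and q :: real and N :: nat
  assumes N_pos: "0 < N"
    and occupied_measurable [measurable]: "\<And>j. Measurable.pred M (\<lambda>\<omega>. j \<in> U \<omega>)"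
    and occupied_unbounded: "\<omega> \<in> space M \<Longrightarrow> \<exists>j\<in>U \<omega>. b \<le> j"
    and prob_pattern: "finite A \<Longrightarrow> finite B \<Longrightarrow> A \<inter> B = {} \<Longrightarrow>
        prob {\<omega>\<in>space M. A \<subseteq> U \<omega> \<and> B \<inter> U \<omega> = {}} = (1 - q) ^ card A * q ^ card B"
begin

lemma greedy_cell_measurable [measurable]:
  "(\<lambda>\<omega>. greedy_cell N (U \<omega>) m) \<in> measurable M (count_space UNIV)"
  by (induction m) simp_all

lemma gap_empty_measurable [measurable]:
  "Measurable.pred M (\<lambda>\<omega>. cell_gap N w k \<inter> U \<omega> = {})"
proof -
  have "(cell_gap N w k \<inter> U \<omega> = {}) = (\<forall>j. j \<in> cell_gap N w k \<longrightarrow> j \<notin> U \<omega>)" for \<omega> by auto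
  then show ?thesis by simp
qed

text \<open>
  Fixing the discrete star points prescribes the states of the cells \<open>A\<close> found
  and of the cells \<open>J\<close> searched in vain. The cells \<open>G\<close> of the gaps
  are disjoint from both, so that emptiness of the gaps only contributes the factor
  \<open>q ^ card G\<close>.
\<close>

lemma prob_greedy_cells_and_empty_gaps:
  "prob {\<omega>\<in>space M. (\<forall>m<n. greedy_cell N (U \<omega>) m = k m) \<and> (\<forall>m<n. cell_gap N w (k m) \<inter> U \<omega> = {})} =
   prob {\<omega>\<in>space M. \<forall>m<n. greedy_cell N (U \<omega>) m = k m} * q ^ (\<Sum>m<n. card (cell_gap N w (k m)))"
proof (cases "\<forall>m<n. search_start N k m \<le> k m")
  case False
  then have none: "\<not> (\<forall>m<n. greedy_cell N (U \<omega>) m = k m)" if "\<omega> \<in> space M" for \<omega>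
    using greedy_cells_eq_iff[of "U \<omega>", OF occupied_unbounded[OF that]] by blast
  have "{\<omega>\<in>space M. (\<forall>m<n. greedy_cell N (U \<omega>) m = k m) \<and> (\<forall>m<n. cell_gap N w (k m) \<inter> U \<omega> = {})} = {}"
    "{\<omega>\<in>space M. \<forall>m<n. greedy_cell N (U \<omega>) m = k m} = {}" using none by blast+
  then show ?thesis by (simp only: measure_empty mult_zero_left)
next
  case True
  then have chain: "\<And>m. m < n \<Longrightarrow> search_start N k m \<le> k m" by blast
  note uniq = search_blocks_disjoint[of n N k, OF chain]
  define A where "A = k ` {..<n}"
  define J where "J = (\<Union>m<n. {search_start N k m..<k m})"
  define G where "G = (\<Union>m<n. cell_gap N w (k m))"
  have fin: "finite A" "finite J" "finite G"
    by (auto simp: A_def J_def G_def finite_cell_gap)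
  have AJ: "A \<inter> J = {}"
  proof (rule equals0I)
    fix x assume "x \<in> A \<inter> J"
    then obtain m m' where "m < n" "x = k m" "m' < n" "search_start N k m' \<le> x" "x < k m'"
      by (auto simp: A_def J_def)
    then show False using uniq[of m x m'] chain[of m] N_pos by auto
  qed
  have AG: "A \<inter> G = {}"
  proof (rule equals0I)
    fix x assume "x \<in> A \<inter> G"
    then obtain m m' where "m < n" "x = k m" "m' < n" "k m' < x" "x < k m' + N"
      by (auto simp: A_def G_def cell_gap_def)
    then show False using uniq[of m x m'] chain[of m] chain[of m'] N_pos by auto
  qed
  have JG: "J \<inter> G = {}"
  proof (rule equals0I)
    fix x assume "x \<in> J \<inter> G"
    then obtain m m' where "m < n" "search_start N k m \<le> x" "x < k m" "m' < n" "k m' < x" "x < k m' + N"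
      by (auto simp: J_def G_def cell_gap_def)
    then show False using uniq[of m x m'] chain[of m'] by auto
  qed
  have card_G: "card G = (\<Sum>m<n. card (cell_gap N w (k m)))"
    unfolding G_def
  proof (rule card_UN_disjoint)
    show "\<forall>i\<in>{..<n}. \<forall>j\<in>{..<n}. i \<noteq> j \<longrightarrow> cell_gap N w (k i) \<inter> cell_gap N w (k j) = {}"
    proof (intro ballI impI equals0I)
      fix i j x assume "i \<in> {..<n}" "j \<in> {..<n}" "i \<noteq> j" "x \<in> cell_gap N w (k i) \<inter> cell_gap N w (k j)"
      then show False using uniq[of i x j] chain[of i] chain[of j] by (auto simp: cell_gap_def)
    qed
  qed (auto simp: finite_cell_gap)
  have cells: "(\<forall>m<n. greedy_cell N (U \<omega>) m = k m) \<longleftrightarrow> A \<subseteq> U \<omega> \<and> J \<inter> U \<omega> = {}"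
    if "\<omega> \<in> space M" for \<omega>
    unfolding greedy_cells_eq_iff[of "U \<omega>", OF occupied_unbounded[OF that]]
    using chain by (auto simp: A_def J_def)
  have "{\<omega>\<in>space M. (\<forall>m<n. greedy_cell N (U \<omega>) m = k m) \<and> (\<forall>m<n. cell_gap N w (k m) \<inter> U \<omega> = {})} =
      {\<omega>\<in>space M. A \<subseteq> U \<omega> \<and> (J \<union> G) \<inter> U \<omega> = {}}"
    using cells by (auto simp: G_def)
  moreover have "{\<omega>\<in>space M. \<forall>m<n. greedy_cell N (U \<omega>) m = k m} =
      {\<omega>\<in>space M. A \<subseteq> U \<omega> \<and> J \<inter> U \<omega> = {}}"
    using cells by auto
  moreover have "A \<inter> (J \<union> G) = {}" using AJ AG by blast
  ultimately show ?thesis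
    using fin AJ JG by (simp add: prob_pattern card_Un_disjoint power_add card_G)
qed

text \<open>
  Summation of the preceding identity over all admissible values of the discrete star points.
  The conditions \<open>c\<close> leave only finitely many values, so the sum is finite.
\<close>

lemma prob_empty_gaps_eq_expectation:
  assumes fin: "\<And>m. finite {j. c m j}"
  shows "prob {\<omega>\<in>space M. (\<forall>m<n. c m (greedy_cell N (U \<omega>) m)) \<and>
             (\<forall>m<n. cell_gap N w (greedy_cell N (U \<omega>) m) \<inter> U \<omega> = {})} =
         (\<integral>\<omega>. indicator {\<omega>\<in>space M. \<forall>m<n. c m (greedy_cell N (U \<omega>) m)} \<omega> *
             q ^ (\<Sum>m<n. card (cell_gap N w (greedy_cell N (U \<omega>) m))) \<partial>M)"
proof -
  define S where "S = (PiE {..<n} (\<lambda>m. {j. c m j}))"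
  (* Restricting to the first n entries turns the random sequence into an element of the finite
     set S, and the events E k with k in S are pairwise disjoint. *)
  define K where "K \<omega> = (\<lambda>m\<in>{..<n}. greedy_cell N (U \<omega>) m)" for \<omega>
  define E where "E k = {\<omega>\<in>space M. \<forall>m<n. greedy_cell N (U \<omega>) m = k m}" for k
  define F where "F k = {\<omega>\<in>space M. (\<forall>m<n. greedy_cell N (U \<omega>) m = k m) \<and>
      (\<forall>m<n. cell_gap N w (k m) \<inter> U \<omega> = {})}" for k
  define Q where "Q k = q ^ (\<Sum>m<n. card (cell_gap N w (k m)))" for k
  have finS: "finite S" unfolding S_def by (intro finite_PiE) (use fin in auto)
  have [measurable]: "E k \<in> events" "F k \<in> events" for k by (simp_all add: E_def F_def)
  have EK: "\<omega> \<in> E k \<longleftrightarrow> \<omega> \<in> space M \<and> k = K \<omega>" if "k \<in> S" for k \<omega>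
    using that by (auto simp: E_def K_def S_def PiE_def extensional_def fun_eq_iff)
  have KS: "K \<omega> \<in> S \<longleftrightarrow> (\<forall>m<n. c m (greedy_cell N (U \<omega>) m))" for \<omega>
    by (auto simp: K_def S_def)
  have "{\<omega>\<in>space M. (\<forall>m<n. c m (greedy_cell N (U \<omega>) m)) \<and>
         (\<forall>m<n. cell_gap N w (greedy_cell N (U \<omega>) m) \<inter> U \<omega> = {})} = (\<Union>k\<in>S. F k)"
    (is "?B = _")
  proof (intro equalityI subsetI)
    fix \<omega> assume "\<omega> \<in> ?B"
    then have "K \<omega> \<in> S" "\<omega> \<in> F (K \<omega>)" by (auto simp: KS F_def) (auto simp: K_def)
    then show "\<omega> \<in> (\<Union>k\<in>S. F k)" by blast
  next
    fix \<omega> assume "\<omega> \<in> (\<Union>k\<in>S. F k)"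
    then obtain k where "k \<in> S" "\<omega> \<in> F k" by blast
    then show "\<omega> \<in> ?B" by (auto simp: F_def S_def PiE_iff)
  qed
  moreover have "disjoint_family_on F S"
    unfolding disjoint_family_on_def
  proof (intro ballI impI equals0I)
    fix k l \<omega> assume kl: "k \<in> S" "l \<in> S" "k \<noteq> l" "\<omega> \<in> F k \<inter> F l"
    then have "\<omega> \<in> E k" "\<omega> \<in> E l" by (auto simp: E_def F_def)
    then show False using EK[OF kl(1)] EK[OF kl(2)] kl(3) by metis
  qed
  moreover have "F ` S \<subseteq> events" by (auto simp: F_def)
  ultimately have "prob ?B = (\<Sum>k\<in>S. prob (F k))"
    using finite_measure_finite_Union[OF finS] by metis
  also have "\<dots> = (\<Sum>k\<in>S. prob (E k) * Q k)"
    by (simp add: F_def E_def Q_def prob_greedy_cells_and_empty_gaps)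
  also have "\<dots> = (\<integral>\<omega>. (\<Sum>k\<in>S. indicator (E k) \<omega> * Q k) \<partial>M)"
    by (subst Bochner_Integration.integral_sum) (auto simp: emeasure_eq_measure)
  also have "\<dots> = (\<integral>\<omega>. indicator {\<omega>\<in>space M. \<forall>m<n. c m (greedy_cell N (U \<omega>) m)} \<omega> *
             q ^ (\<Sum>m<n. card (cell_gap N w (greedy_cell N (U \<omega>) m))) \<partial>M)"
  proof (intro Bochner_Integration.integral_cong refl)
    fix \<omega> assume w: "\<omega> \<in> space M"
    have "(\<Sum>k\<in>S. indicator (E k) \<omega> * Q k) = (\<Sum>k\<in>S. if k = K \<omega> then Q k else 0)"
      using EK w by (intro sum.cong) (auto simp: indicator_def)
    also have "\<dots> = (if K \<omega> \<in> S then Q (K \<omega>) else 0)" using finS by simp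
    also have "Q (K \<omega>) = q ^ (\<Sum>m<n. card (cell_gap N w (greedy_cell N (U \<omega>) m)))"
      by (simp add: Q_def K_def)
    finally show "(\<Sum>k\<in>S. indicator (E k) \<omega> * Q k) =
        indicator {\<omega>\<in>space M. \<forall>m<n. c m (greedy_cell N (U \<omega>) m)} \<omega> *
             q ^ (\<Sum>m<n. card (cell_gap N w (greedy_cell N (U \<omega>) m)))"
      using w by (simp add: KS indicator_def)
  qed
  finally show ?thesis .
qed

end

section \<open>Cells of a Poisson process\<close>

definition cell :: "nat \<Rightarrow> nat \<Rightarrow> real set" where
  "cell N j = {real j / real N..<(real j + 1) / real N}"

lemma mem_cell_iff:
  assumes "N > 0" "0 \<le> p" shows "p \<in> cell N j \<longleftrightarrow> nat \<lfloor>real N * p\<rfloor> = j"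
proof -
  have "p \<in> cell N j \<longleftrightarrow> real j \<le> real N * p \<and> real N * p < real j + 1"
    using assms by (simp add: cell_def field_simps)
  also have "\<dots> \<longleftrightarrow> \<lfloor>real N * p\<rfloor> = int j" by (simp add: floor_eq_iff)
  also have "\<dots> \<longleftrightarrow> nat \<lfloor>real N * p\<rfloor> = j" using assms by (auto simp: nat_eq_iff)
  finally show ?thesis .
qed

lemma cell_nonempty: "N > 0 \<Longrightarrow> real j / real N \<in> cell N j"
  by (simp add: cell_def divide_strict_right_mono)

lemma cell_subset: "N > 0 \<Longrightarrow> cell N j \<subseteq> {0..}"
  by (auto simp: cell_def) (meson divide_nonneg_nonneg of_nat_0_le_iff order_trans)

lemma cell_disjoint:
  assumes "N > 0" "i \<noteq> j" shows "cell N i \<inter> cell N j = {}"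
proof -
  have False if "p \<in> cell N i" "p \<in> cell N j" for p
  proof -
    have "0 \<le> p" using cell_subset[of N i] that assms by auto
    then show False using mem_cell_iff[of N p] that assms by auto
  qed
  then show ?thesis by blast
qed

locale poisson_points = prob_space M for M :: "'a measure" +
  fixes lam :: real and X :: "nat \<Rightarrow> 'a \<Rightarrow> real"
  assumes lam_pos: "0 < lam"
    and poisson: "homogeneous_poisson_process M lam X"
begin

abbreviation points :: "'a \<Rightarrow> real set" where
  "points \<omega> \<equiv> point_set (\<lambda>i. X i \<omega>)"

lemma
  shows X_measurable: "1 \<le> i \<Longrightarrow> X i \<in> borel_measurable M"
    and point_sequence_path: "\<omega> \<in> space M \<Longrightarrow> point_sequence (\<lambda>i. X i \<omega>)"
    and prob_num_points: "A \<in> sets borel \<Longrightarrow> bounded A \<Longrightarrow> A \<subseteq> {0..} \<Longrightarrow>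
      prob {\<omega>\<in>space M. num_points X A \<omega> = n} =
        (lam * measure lborel A) ^ n / fact n * exp (- (lam * measure lborel A))"
    and indep_num_points: "finite \<A> \<Longrightarrow> (\<And>A. A \<in> \<A> \<Longrightarrow> A \<in> sets borel \<and> bounded A \<and> A \<subseteq> {0..}) \<Longrightarrow>
      disjoint \<A> \<Longrightarrow> indep_vars (\<lambda>_. count_space UNIV) (num_points X) \<A>"
  using poisson unfolding homogeneous_poisson_process_def
  by (elim conjE, simp_all add: point_sequence_def)

lemma num_points_measurable:
  assumes "A \<in> sets borel" "bounded A" "A \<subseteq> {0..}"
  shows "num_points X A \<in> measurable M (count_space UNIV)"
proof -
  have "indep_vars (\<lambda>_. count_space UNIV) (num_points X) {A}"
    using assms by (intro indep_num_points) (auto simp: disjoint_def)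
  then show ?thesis by (simp add: indep_vars_def)
qed

lemma cell_admissible: "N > 0 \<Longrightarrow> cell N j \<in> sets borel \<and> bounded (cell N j) \<and> cell N j \<subseteq> {0..}"
  using cell_subset[of N j] by (auto simp: cell_def)

lemma occupied_cells_iff:
  assumes "N > 0" "\<omega> \<in> space M"
  shows "j \<in> occupied_cells N (points \<omega>) \<longleftrightarrow> num_points X (cell N j) \<omega> \<noteq> 0"
proof -
  interpret point_sequence "\<lambda>i. X i \<omega>" using point_sequence_path assms by blast
  have "finite {i. 1 \<le> i \<and> X i \<omega> \<in> cell N j}"
    by (rule finite_subset[OF _ finite_seq[of "(real j + 1) / real N"]]) (auto simp: cell_def)
  then have "num_points X (cell N j) \<omega> \<noteq> 0 \<longleftrightarrow> (\<exists>i\<ge>1. X i \<omega> \<in> cell N j)"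
    by (auto simp: num_points_def card_eq_0_iff)
  also have "\<dots> \<longleftrightarrow> (\<exists>i\<ge>1. nat \<lfloor>real N * X i \<omega>\<rfloor> = j)"
    using mem_cell_iff[OF assms(1)] nonneg_seq by blast
  finally show ?thesis by (auto simp: occupied_cells_def point_set_def)
qed

lemma prob_cell_empty:
  assumes "N > 0"
  shows "prob {\<omega>\<in>space M. num_points X (cell N j) \<omega> = 0} = exp (- lam / real N)"
proof -
  have "measure lborel (cell N j) = 1 / real N"
    using assms by (simp add: cell_def divide_right_mono diff_divide_distrib[symmetric])
  then show ?thesis using prob_num_points[of "cell N j" 0] cell_admissible[OF assms, of j] by simp
qed

lemma bernoulli_occupied_cells:
  assumes N: "N > 0"
  shows "bernoulli_cells M (\<lambda>\<omega>. occupied_cells N (points \<omega>)) (exp (- lam / real N)) N"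
proof
  show "0 < N" by (rule N)
  have num_meas [measurable]: "num_points X (cell N j) \<in> measurable M (count_space UNIV)" for j
    using num_points_measurable cell_admissible[OF N] by blast
  show "Measurable.pred M (\<lambda>\<omega>. j \<in> occupied_cells N (points \<omega>))" for j
  proof -
    have "Measurable.pred M (\<lambda>\<omega>. num_points X (cell N j) \<omega> \<noteq> 0)" by measurable
    then show ?thesis
      by (rule measurable_cong[THEN iffD2, rotated]) (rule occupied_cells_iff[OF N])
  qed
  fix \<omega> b assume "\<omega> \<in> space M"
  then interpret point_sequence "\<lambda>i. X i \<omega>" using point_sequence_path by blast
  show "\<exists>j\<in>occupied_cells N (points \<omega>). b \<le> j" using occupied_cells_unbounded[OF N] .
next
  fix A B :: "nat set" assume fin: "finite A" "finite B" and disj: "A \<inter> B = {}"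
  have num_meas [measurable]: "num_points X (cell N j) \<in> measurable M (count_space UNIV)" for j
    using num_points_measurable cell_admissible[OF N] by blast
  define V where "V j = (if j \<in> A then {0<..} else {0::nat})" for j
  have inj: "inj_on (cell N) (A \<union> B)"
  proof (rule inj_onI)
    fix i j assume "cell N i = cell N j"
    then show "i = j" using cell_disjoint[OF N, of i j] cell_nonempty[OF N, of i] by auto
  qed
  have pat: "{\<omega>\<in>space M. A \<subseteq> occupied_cells N (points \<omega>) \<and> B \<inter> occupied_cells N (points \<omega>) = {}} =
      {\<omega>\<in>space M. \<forall>j\<in>A\<union>B. num_points X (cell N j) \<omega> \<in> V j}"
  proof -
    have "(\<forall>j\<in>A\<union>B. num_points X (cell N j) \<omega> \<in> V j) \<longleftrightarrow>
        (\<forall>j\<in>A. num_points X (cell N j) \<omega> \<noteq> 0) \<and> (\<forall>j\<in>B. num_points X (cell N j) \<omega> = 0)" for \<omega>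
      using disj by (auto simp: V_def)
    then show ?thesis using occupied_cells_iff[OF N] by auto
  qed
  show "prob {\<omega>\<in>space M. A \<subseteq> occupied_cells N (points \<omega>) \<and> B \<inter> occupied_cells N (points \<omega>) = {}} =
      (1 - exp (- lam / real N)) ^ card A * exp (- lam / real N) ^ card B"
  proof (cases "A \<union> B = {}")
    case True then show ?thesis by (simp add: prob_space)
  next
    case False
    let ?C = "cell N ` (A \<union> B)"
    define W where "W c = (if c \<in> cell N ` A then {0<..} else {0::nat})" for c
    have W: "W (cell N j) = V j" if "j \<in> A \<union> B" for j
      using inj_on_image_mem_iff[OF inj that, of A] by (simp add: W_def V_def)
    have "disjoint ?C"
    proof (rule disjointI)
      fix a b assume "a \<in> ?C" "b \<in> ?C" "a \<noteq> b"
      then obtain i j where "a = cell N i" "b = cell N j" "i \<noteq> j" by blast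
      then show "a \<inter> b = {}" using cell_disjoint[OF N, of i j] by simp
    qed
    then have "indep_vars (\<lambda>_. count_space UNIV) (num_points X) ?C"
      using cell_admissible[OF N] fin by (intro indep_num_points) auto
    then have "prob (\<Inter>c\<in>?C. num_points X c -` W c \<inter> space M) =
        (\<Prod>c\<in>?C. prob (num_points X c -` W c \<inter> space M))"
    proof (rule indep_varsD_finite)
      show "?C \<noteq> {}" "finite ?C" using fin False by simp_all
    qed simp
    also have "(\<Inter>c\<in>?C. num_points X c -` W c \<inter> space M) =
        {\<omega>\<in>space M. \<forall>j\<in>A\<union>B. num_points X (cell N j) \<omega> \<in> V j}"
    proof -
      obtain j where "j \<in> A \<union> B" using False by blast
      then show ?thesis by (auto simp: W)
    qed
    also have "(\<Prod>c\<in>?C. prob (num_points X c -` W c \<inter> space M)) =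
        (\<Prod>j\<in>A\<union>B. prob (num_points X (cell N j) -` V j \<inter> space M))"
      unfolding prod.reindex[OF inj] comp_def by (rule prod.cong[OF refl]) (simp only: W)
    also have "\<dots> = (\<Prod>j\<in>A\<union>B. if j \<in> A then 1 - exp (- lam / real N) else exp (- lam / real N))"
    proof (intro prod.cong refl)
      fix j
      have "num_points X (cell N j) -` {0} \<inter> space M = {\<omega>\<in>space M. num_points X (cell N j) \<omega> = 0}"
        by auto
      then have zero: "prob (num_points X (cell N j) -` {0} \<inter> space M) = exp (- lam / real N)"
        using prob_cell_empty[OF N, of j] by simp
      have "num_points X (cell N j) -` {0<..} \<inter> space M =
          space M - (num_points X (cell N j) -` {0} \<inter> space M)" by auto
      then have "prob (num_points X (cell N j) -` {0<..} \<inter> space M) = 1 - exp (- lam / real N)"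
        using zero by (simp add: prob_compl)
      with zero show "prob (num_points X (cell N j) -` V j \<inter> space M) =
          (if j \<in> A then 1 - exp (- lam / real N) else exp (- lam / real N))"
        by (simp add: V_def)
    qed
    also have "\<dots> = (1 - exp (- lam / real N)) ^ card A * exp (- lam / real N) ^ card B"
    proof -
      have "(\<Prod>j\<in>A. if j \<in> A then 1 - exp (- lam / real N) else exp (- lam / real N)) =
          (1 - exp (- lam / real N)) ^ card A" by simp
      moreover have "(\<Prod>j\<in>B. if j \<in> A then 1 - exp (- lam / real N) else exp (- lam / real N)) =
          (\<Prod>j\<in>B. exp (- lam / real N))" using disj by (intro prod.cong) auto
      ultimately show ?thesis using fin disj by (simp add: prod.union_disjoint)
    qed
    finally show ?thesis unfolding pat .
  qed
qed

text \<open>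
  Two points at distance exactly 1 occupy cells whose indices differ by exactly
  \<open>N\<close>. For a given pair of cells this has probability at most
  \<open>(lam / N)\<^sup>2\<close>, and there are only of order \<open>N\<close> pairs below a
  given bound.
\<close>

lemma AE_no_unit_distance: "AE \<omega> in M. \<forall>p\<in>points \<omega>. p + 1 \<notin> points \<omega>"
proof -
  define V where "V T = {\<omega>\<in>space M. \<exists>i\<in>{1..}. \<exists>j\<in>{1..}. X i \<omega> \<le> real T \<and> X j \<omega> = X i \<omega> + 1}" for T
  have V_meas: "V T \<in> events" for T
  proof -
    have "V T = (\<Union>i\<in>{1..}. \<Union>j\<in>{1..}. {\<omega>\<in>space M. X i \<omega> \<le> real T \<and> X j \<omega> = X i \<omega> + 1})"
      by (auto simp: V_def)
    moreover have "{\<omega>\<in>space M. X i \<omega> \<le> real T \<and> X j \<omega> = X i \<omega> + 1} \<in> events"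
      if "i \<in> {1..}" "j \<in> {1..}" for i j
    proof -
      have [measurable]: "X i \<in> borel_measurable M" "X j \<in> borel_measurable M"
        using X_measurable that by auto
      show ?thesis by simp
    qed
    ultimately show ?thesis by (auto intro!: sets.countable_UN'')
  qed
  have bound: "prob (V T) \<le> real (T + 1) * lam\<^sup>2 / real N" if N: "N > 0" for T N
  proof -
    interpret cells: bernoulli_cells M "\<lambda>\<omega>. occupied_cells N (points \<omega>)" "exp (- lam / real N)" N
      by (rule bernoulli_occupied_cells[OF N])
    let ?D = "\<lambda>k. {\<omega>\<in>space M. {k, k + N} \<subseteq> occupied_cells N (points \<omega>)}"
    have "?D k \<in> events" for k by simp
    then have Dm: "?D ` {..<(T + 1) * N} \<subseteq> events" by blast
    have "V T \<subseteq> (\<Union>k<(T + 1) * N. ?D k)"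
    proof
      fix \<omega> assume "\<omega> \<in> V T"
      then obtain i j where ij: "\<omega> \<in> space M" "1 \<le> i" "1 \<le> j" "X i \<omega> \<le> real T" "X j \<omega> = X i \<omega> + 1"
        by (auto simp: V_def)
      then have X0: "0 \<le> X i \<omega>" using point_sequence.nonneg_seq[OF point_sequence_path] by blast
      define k where "k = nat \<lfloor>real N * X i \<omega>\<rfloor>"
      have "real N * X j \<omega> = real N * X i \<omega> + of_int (int N)" using ij by (simp add: algebra_simps)
      then have "nat \<lfloor>real N * X j \<omega>\<rfloor> = k + N"
        using X0 by (simp add: k_def nat_add_distrib)
      then have "{k, k + N} \<subseteq> occupied_cells N (points \<omega>)"
        using ij by (force simp: occupied_cells_def point_set_def k_def)
      moreover have "k < (T + 1) * N"
      proof -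
        have "real k \<le> real N * X i \<omega>" using X0 by (simp add: k_def)
        also have "\<dots> \<le> real N * real T" using ij by (intro mult_left_mono) auto
        also have "\<dots> < real ((T + 1) * N)" using N by (simp add: algebra_simps)
        finally show ?thesis using of_nat_less_iff by blast
      qed
      ultimately show "\<omega> \<in> (\<Union>k<(T + 1) * N. ?D k)" using ij by blast
    qed
    then have "prob (V T) \<le> prob (\<Union>k<(T + 1) * N. ?D k)"
      using Dm by (intro finite_measure_mono) auto
    also have "\<dots> \<le> (\<Sum>k<(T + 1) * N. prob (?D k))"
      by (rule finite_measure_subadditive_finite) (use Dm in auto)
    also have "\<dots> \<le> (\<Sum>k<(T + 1) * N. (lam / real N)\<^sup>2)"
    proof (rule sum_mono)
      fix k
      have "prob (?D k) = (1 - exp (- lam / real N)) ^ 2"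
        using cells.prob_pattern[of "{k, k + N}" "{}"] N by (simp add: power2_eq_square)
      moreover have "1 - exp (- lam / real N) \<le> lam / real N"
        using exp_ge_add_one_self[of "- lam / real N"] by simp
      moreover have "0 \<le> 1 - exp (- lam / real N)" using lam_pos by simp
      ultimately show "prob (?D k) \<le> (lam / real N)\<^sup>2" using power_mono by metis
    qed
    also have "\<dots> = real (T + 1) * lam\<^sup>2 / real N"
      using N by (simp add: power2_eq_square field_simps)
    finally show ?thesis .
  qed
  have "AE \<omega> in M. \<omega> \<notin> V T" for T
  proof -
    have "prob (V T) \<le> 0"
    proof (rule tendsto_lowerbound)
      show "(\<lambda>N. real (T + 1) * lam\<^sup>2 / real N) \<longlonglongrightarrow> 0" by (rule lim_const_over_n)
      show "\<forall>\<^sub>F N in sequentially. prob (V T) \<le> real (T + 1) * lam\<^sup>2 / real N"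
        using eventually_gt_at_top[of 0] by eventually_elim (rule bound)
    qed simp
    then have "prob (V T) = 0" using measure_nonneg[of M "V T"] by linarith
    then show ?thesis using V_meas by (intro AE_not_in) (simp add: null_sets_def emeasure_eq_measure)
  qed
  then have "AE \<omega> in M. \<forall>T. \<omega> \<notin> V T" by (simp add: AE_all_countable)
  with AE_space show ?thesis
  proof eventually_elim
    case (elim \<omega>)
    show ?case
    proof (intro ballI notI)
      fix p assume p: "p \<in> points \<omega>" "p + 1 \<in> points \<omega>"
      obtain T where "p \<le> real T" using real_arch_simple by blast
      then have "\<omega> \<in> V T" using p elim by (force simp: V_def point_set_def)
      then show False using elim by blast
    qed
  qed
qed

section \<open>Passage to the limit\<close>

lemma greedy_point_measurable [measurable]:
  "(\<lambda>\<omega>. greedy_point (points \<omega>) m) \<in> borel_measurable M"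
proof (rule borel_measurable_LIMSEQ_real)
  fix \<omega> assume "\<omega> \<in> space M"
  then interpret point_sequence "\<lambda>i. X i \<omega>" by (rule point_sequence_path)
  show "(\<lambda>N. real (greedy_cell (Suc N) (occupied_cells (Suc N) (points \<omega>)) m) / real (Suc N))
      \<longlonglongrightarrow> greedy_point (points \<omega>) m"
    by (rule LIMSEQ_Suc[OF greedy_cell_tendsto])
next
  fix N
  interpret cells: bernoulli_cells M "\<lambda>\<omega>. occupied_cells (Suc N) (points \<omega>)"
    "exp (- lam / real (Suc N))" "Suc N"
    by (rule bernoulli_occupied_cells) simp
  show "(\<lambda>\<omega>. real (greedy_cell (Suc N) (occupied_cells (Suc N) (points \<omega>)) m) / real (Suc N))
      \<in> borel_measurable M"
    by (intro borel_measurable_divide borel_measurable_const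
        measurable_compose[OF cells.greedy_cell_measurable]) simp
qed

lemma star_point_path:
  "\<omega> \<in> space M \<Longrightarrow> star_point (\<lambda>i. X i \<omega>) (Suc m) = greedy_point (points \<omega>) m"
  by (rule point_sequence.star_point_eq[OF point_sequence_path])

lemma no_edge_event_eq:
  "no_edge_event M X w = {\<omega>\<in>space M. gilbert_graph (points \<omega> \<inter> {0..w}) = {}}"
proof -
  have "finite (gilbert_graph (points \<omega> \<inter> {0..w}))" if "\<omega> \<in> space M" for \<omega>
  proof -
    interpret point_sequence "\<lambda>i. X i \<omega>" using that by (rule point_sequence_path)
    show ?thesis by (rule finite_gilbert_graph)
  qed
  then show ?thesis by (auto simp: no_edge_event_def)
qed

lemma no_edge_event_measurable [measurable]: "no_edge_event M X w \<in> events"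
proof -
  let ?E = "\<lambda>i j. {\<omega>\<in>space M. X i \<omega> \<le> w \<and> X j \<omega> \<le> w \<and> X i \<omega> \<noteq> X j \<omega> \<and> \<bar>X i \<omega> - X j \<omega>\<bar> \<le> 1}"
  have "no_edge_event M X w = space M - (\<Union>i\<in>{1..}. \<Union>j\<in>{1..}. ?E i j)"
  proof -
    have "gilbert_graph (points \<omega> \<inter> {0..w}) = {} \<longleftrightarrow> \<not> (\<exists>i\<in>{1..}. \<exists>j\<in>{1..}. \<omega> \<in> ?E i j)"
      if "\<omega> \<in> space M" for \<omega>
    proof -
      have "0 \<le> X i \<omega>" if "1 \<le> i" for i
        using point_sequence.nonneg_seq[OF point_sequence_path[OF \<open>\<omega> \<in> space M\<close>] that] .
      then show ?thesis using that by (auto simp: gilbert_graph_def point_set_def)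
    qed
    then show ?thesis unfolding no_edge_event_eq by blast
  qed
  moreover have "?E i j \<in> events" if "i \<in> {1..}" "j \<in> {1..}" for i j
  proof -
    have [measurable]: "X i \<in> borel_measurable M" "X j \<in> borel_measurable M"
      using X_measurable that by auto
    show ?thesis by simp
  qed
  ultimately show ?thesis by (auto intro!: sets.countable_UN'')
qed

text \<open>
  The asserted conditional probability, provided that \<open>n > w\<close>.
\<close>

definition gap_weight :: "real \<Rightarrow> nat \<Rightarrow> 'a \<Rightarrow> real" where
  "gap_weight w n \<omega> = exp (- lam * (\<Sum>m<n. gap_length w (greedy_point (points \<omega>) m)))"

lemma gap_weight_measurable [measurable]: "gap_weight w n \<in> borel_measurable M"
  unfolding gap_weight_def gap_length_def by measurable

lemma gap_weight_bounds: "0 \<le> gap_weight w n \<omega>" "gap_weight w n \<omega> \<le> 1"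
proof -
  have "0 \<le> (\<Sum>m<n. gap_length w (greedy_point (points \<omega>) m))"
    by (intro sum_nonneg) (simp add: gap_length_def)
  then show "gap_weight w n \<omega> \<le> 1" using lam_pos by (simp add: gap_weight_def)
qed (simp add: gap_weight_def)

text \<open>
  The discrete identity passes to the limit. Both sides converge by dominated convergence,
  since all integrands are bounded by 1. The absence of points at distance exactly 1 enters in
  the convergence of the gap events to \<open>E\<^sub>0\<close>.
\<close>

lemma integral_cylinder_no_edge:
  assumes w: "0 \<le> w" and n: "w < real n"
  shows "(\<integral>\<omega>. indicator {\<omega>\<in>space M. \<forall>m<n. greedy_point (points \<omega>) m < t m} \<omega> *
             indicator (no_edge_event M X w) \<omega> \<partial>M) =
         (\<integral>\<omega>. indicator {\<omega>\<in>space M. \<forall>m<n. greedy_point (points \<omega>) m < t m} \<omega> *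
             gap_weight w n \<omega> \<partial>M)"
    (is "(\<integral>\<omega>. indicator ?C \<omega> * indicator ?E \<omega> \<partial>M) = (\<integral>\<omega>. indicator ?C \<omega> * _ \<omega> \<partial>M)")
proof -
  define U where "U N \<omega> = occupied_cells N (points \<omega>)" for N \<omega>
  define K where "K N \<omega> m = greedy_cell N (U N \<omega>) m" for N \<omega> m
  define CN where "CN N = {\<omega>\<in>space M. \<forall>m<n. real (K N \<omega> m) + 1 < t m * real N}" for N
  define EN where "EN N = {\<omega>\<in>space M. \<forall>m<n. cell_gap N w (K N \<omega> m) \<inter> U N \<omega> = {}}" for N
  define QN where "QN N \<omega> = exp (- lam / real N) ^ (\<Sum>m<n. card (cell_gap N w (K N \<omega> m)))" for N \<omega>
  (* The mesh 1/N only makes sense for positive N, hence the index shift. *)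
  have cells: "bernoulli_cells M (U (Suc N)) (exp (- lam / real (Suc N))) (Suc N)" for N
    using bernoulli_occupied_cells[of "Suc N"] by (simp add: U_def[abs_def])
  have K_meas [measurable]: "(\<lambda>\<omega>. K (Suc N) \<omega> m) \<in> measurable M (count_space UNIV)" for N m
    unfolding K_def by (rule bernoulli_cells.greedy_cell_measurable[OF cells])
  have gap_meas [measurable]:
    "Measurable.pred M (\<lambda>\<omega>. cell_gap (Suc N) w k \<inter> U (Suc N) \<omega> = {})" for N k
    by (rule bernoulli_cells.gap_empty_measurable[OF cells])
  have CN_meas [measurable]: "CN (Suc N) \<in> events" for N unfolding CN_def by measurable
  have EN_meas [measurable]: "EN (Suc N) \<in> events" for N
  proof -
    have "Measurable.pred M (\<lambda>\<omega>. cell_gap (Suc N) w (K (Suc N) \<omega> m) \<inter> U (Suc N) \<omega> = {})" for m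
      by (rule measurable_compose_countable[OF gap_meas K_meas])
    then show ?thesis unfolding EN_def by measurable
  qed
  have QN_meas [measurable]: "QN (Suc N) \<in> borel_measurable M" for N unfolding QN_def by measurable
  have QN_bounds: "0 \<le> QN N \<omega>" "QN N \<omega> \<le> 1" for N \<omega>
    using lam_pos by (auto simp: QN_def intro!: power_le_one)
  have eq: "(\<integral>\<omega>. indicator (CN (Suc N)) \<omega> * indicator (EN (Suc N)) \<omega> \<partial>M) =
      (\<integral>\<omega>. indicator (CN (Suc N)) \<omega> * QN (Suc N) \<omega> \<partial>M)" for N
  proof -
    have "finite {j. real j + 1 < t m * real (Suc N)}" for m
    proof (rule finite_subset)
      show "{j. real j + 1 < t m * real (Suc N)} \<subseteq> {..nat \<lceil>t m * real (Suc N)\<rceil>}"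
      proof
        fix j assume "j \<in> {j. real j + 1 < t m * real (Suc N)}"
        then have "real j \<le> t m * real (Suc N)" by simp
        then show "j \<in> {..nat \<lceil>t m * real (Suc N)\<rceil>}" by (simp add: le_nat_iff) linarith
      qed
    qed simp
    from bernoulli_cells.prob_empty_gaps_eq_expectation[OF cells this, where n=n and w=w]
    have "prob (CN (Suc N) \<inter> EN (Suc N)) = (\<integral>\<omega>. indicator (CN (Suc N)) \<omega> * QN (Suc N) \<omega> \<partial>M)"
      unfolding CN_def EN_def QN_def K_def by (simp add: Int_def conj_ac cong: conj_cong)
    then show ?thesis by (simp flip: indicator_inter_arith)
  qed
  have path: "\<forall>\<^sub>F N in sequentially. (\<omega> \<in> CN N \<longleftrightarrow> \<omega> \<in> ?C)"
      "(\<lambda>N. QN N \<omega>) \<longlonglongrightarrow> gap_weight w n \<omega>"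
      "(\<forall>p\<in>points \<omega>. p + 1 \<notin> points \<omega>) \<Longrightarrow> \<forall>\<^sub>F N in sequentially. (\<omega> \<in> EN N \<longleftrightarrow> \<omega> \<in> ?E)"
    if \<omega>: "\<omega> \<in> space M" for \<omega>
  proof -
    interpret point_sequence "\<lambda>i. X i \<omega>" using \<omega> by (rule point_sequence_path)
    have "\<forall>\<^sub>F N in sequentially. \<forall>m\<in>{..<n}.
        real (K N \<omega> m) + 1 < t m * real N \<longleftrightarrow> greedy_point (points \<omega>) m < t m"
      unfolding K_def U_def by (intro eventually_ball_finite ballI eventually_cell_less_iff) simp
    then show "\<forall>\<^sub>F N in sequentially. (\<omega> \<in> CN N \<longleftrightarrow> \<omega> \<in> ?C)"
      by eventually_elim (use \<omega> in \<open>auto simp: CN_def\<close>)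
    have "(\<lambda>N. exp (- lam * (\<Sum>m<n. real (card (cell_gap N w (K N \<omega> m))) / real N)))
        \<longlonglongrightarrow> gap_weight w n \<omega>"
      unfolding gap_weight_def K_def U_def by (intro tendsto_intros card_cell_gap_tendsto w)
    moreover have "QN N \<omega> = exp (- lam * (\<Sum>m<n. real (card (cell_gap N w (K N \<omega> m))) / real N))" for N
      by (simp add: QN_def exp_of_nat_mult[symmetric] sum_divide_distrib[symmetric] mult.commute)
    ultimately show "(\<lambda>N. QN N \<omega>) \<longlonglongrightarrow> gap_weight w n \<omega>" by simp
    assume unit: "\<forall>p\<in>points \<omega>. p + 1 \<notin> points \<omega>"
    have "\<forall>\<^sub>F N in sequentially. \<forall>m\<in>{..<n}. cell_gap N w (K N \<omega> m) \<inter> U N \<omega> = {} \<longleftrightarrow>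
        points \<omega> \<inter> {greedy_point (points \<omega>) m<..<greedy_point (points \<omega>) m + 1} \<inter> {..w} = {}"
      unfolding K_def U_def by (intro eventually_ball_finite ballI eventually_cell_gap_iff) simp
    then show "\<forall>\<^sub>F N in sequentially. (\<omega> \<in> EN N \<longleftrightarrow> \<omega> \<in> ?E)"
    proof eventually_elim
      case (elim N)
      have "\<omega> \<in> EN N \<longleftrightarrow> (\<forall>m<n. cell_gap N w (K N \<omega> m) \<inter> U N \<omega> = {})"
        using \<omega> by (simp add: EN_def)
      also have "\<dots> \<longleftrightarrow> (\<forall>m<n. points \<omega> \<inter>
          {greedy_point (points \<omega>) m<..<greedy_point (points \<omega>) m + 1} \<inter> {..w} = {})"
        using elim by blast
      also have "\<dots> \<longleftrightarrow> gilbert_graph (points \<omega> \<inter> {0..w}) = {}"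
        using no_edges_iff_gaps_empty[OF _ n] unit by simp
      finally show ?case using \<omega> by (simp add: no_edge_event_eq)
    qed
  qed
  have "(\<lambda>N. \<integral>\<omega>. indicator (CN (Suc N)) \<omega> * indicator (EN (Suc N)) \<omega> \<partial>M)
      \<longlonglongrightarrow> (\<integral>\<omega>. indicator ?C \<omega> * indicator ?E \<omega> \<partial>M :: real)"
  proof (rule integral_dominated_convergence[where w="\<lambda>_. 1"])
    show "AE \<omega> in M. (\<lambda>N. indicator (CN (Suc N)) \<omega> * indicator (EN (Suc N)) \<omega> :: real)
        \<longlonglongrightarrow> indicator ?C \<omega> * indicator ?E \<omega>"
      using AE_no_unit_distance AE_space
    proof eventually_elim
      case (elim \<omega>)
      have "\<forall>\<^sub>F N in sequentially. indicator (CN N) \<omega> * indicator (EN N) \<omega> =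
          (indicator ?C \<omega> * indicator ?E \<omega> :: real)"
        using path(1)[OF elim(2)] path(3)[OF elim(2) elim(1)]
        by eventually_elim (simp add: indicator_def)
      then show ?case by (intro LIMSEQ_Suc tendsto_eventually)
    qed
  qed (auto simp: indicator_def)
  moreover have "(\<lambda>N. \<integral>\<omega>. indicator (CN (Suc N)) \<omega> * QN (Suc N) \<omega> \<partial>M)
      \<longlonglongrightarrow> (\<integral>\<omega>. indicator ?C \<omega> * gap_weight w n \<omega> \<partial>M)"
  proof (rule integral_dominated_convergence[where w="\<lambda>_. 1"])
    show "AE \<omega> in M. (\<lambda>N. indicator (CN (Suc N)) \<omega> * QN (Suc N) \<omega>)
        \<longlonglongrightarrow> indicator ?C \<omega> * gap_weight w n \<omega>"
      using AE_space
    proof eventually_elim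
      case (elim \<omega>)
      have "\<forall>\<^sub>F N in sequentially. indicator (CN N) \<omega> = (indicator ?C \<omega> :: real)"
        using path(1)[OF elim] by eventually_elim (simp add: indicator_def)
      then have "(\<lambda>N. indicator (CN N) \<omega> :: real) \<longlonglongrightarrow> indicator ?C \<omega>"
        by (rule tendsto_eventually)
      then show ?case by (intro LIMSEQ_Suc tendsto_mult path(2)[OF elim])
    qed
    show "AE \<omega> in M. norm (indicator (CN (Suc N)) \<omega> * QN (Suc N) \<omega>) \<le> 1" for N
      using QN_bounds by (auto simp: indicator_def)
  qed auto
  ultimately show ?thesis unfolding eq by (rule LIMSEQ_unique)
qed

section \<open>Extension to the star algebra\<close>

lemma star_algebra_space [simp]: "space (star_algebra M X) = space M"
  by (simp add: star_algebra_def space_measure_of_conv)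

lemma sets_star_algebra:
  "sets (star_algebra M X) = sigma_sets (space M)
     {(\<lambda>\<omega>. greedy_point (points \<omega>) m) -` B \<inter> space M | m B. B \<in> sets borel}"
    (is "_ = sigma_sets _ ?S")
proof -
  have "{(\<lambda>\<omega>. star_point (\<lambda>j. X j \<omega>) i) -` B \<inter> space M | i B. i \<ge> 1 \<and> B \<in> sets borel} = ?S"
    (is "?L = _")
  proof (intro equalityI subsetI)
    fix A assume "A \<in> ?L"
    then obtain i B where A: "A = (\<lambda>\<omega>. star_point (\<lambda>j. X j \<omega>) i) -` B \<inter> space M" "1 \<le> i" "B \<in> sets borel"
      by blast
    then obtain m where "i = Suc m" by (cases i) auto
    then have "A = (\<lambda>\<omega>. greedy_point (points \<omega>) m) -` B \<inter> space M"
      using A by (auto simp: star_point_path)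
    then show "A \<in> ?S" using A by blast
  next
    fix A assume "A \<in> ?S"
    then obtain m B where A: "A = (\<lambda>\<omega>. greedy_point (points \<omega>) m) -` B \<inter> space M" "B \<in> sets borel"
      by blast
    then have "A = (\<lambda>\<omega>. star_point (\<lambda>j. X j \<omega>) (Suc m)) -` B \<inter> space M"
      by (auto simp: star_point_path)
    moreover have "1 \<le> Suc m" by simp
    ultimately show "A \<in> ?L" using A by blast
  qed
  then show ?thesis unfolding star_algebra_def by (subst sets_measure_of) auto
qed

lemma subalgebra_star_algebra: "subalgebra M (star_algebra M X)"
  unfolding subalgebra_def sets_star_algebra
  by (auto intro!: sets.sigma_sets_subset measurable_sets[OF greedy_point_measurable])

lemma greedy_point_star_measurable [measurable]:
  "(\<lambda>\<omega>. greedy_point (points \<omega>) m) \<in> borel_measurable (star_algebra M X)"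
proof (rule measurableI)
  fix B :: "real set" assume "B \<in> sets borel"
  then show "(\<lambda>\<omega>. greedy_point (points \<omega>) m) -` B \<inter> space (star_algebra M X) \<in> sets (star_algebra M X)"
    unfolding sets_star_algebra star_algebra_space by (intro sigma_sets.Basic) blast
qed simp

lemma gap_weight_star_measurable: "gap_weight w n \<in> borel_measurable (star_algebra M X)"
  unfolding gap_weight_def[abs_def] gap_length_def by measurable

definition cylinder :: "nat \<Rightarrow> (nat \<Rightarrow> real) \<Rightarrow> 'a set" where
  "cylinder n t = {\<omega>\<in>space M. \<forall>m<n. greedy_point (points \<omega>) m < t m}"

lemma cylinder_measurable [measurable]: "cylinder n t \<in> events"
  unfolding cylinder_def by measurable

text \<open>
  The lower bound \<open>n0\<close> on the number of prescribed star points is kept because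
  the identity for cylinders holds only when all gaps up to \<open>w\<close> are accounted
  for.
\<close>

lemma Int_stable_cylinders: "Int_stable {cylinder n t | n t. n0 \<le> n}"
proof (rule Int_stableI)
  fix A B assume "A \<in> {cylinder n t | n t. n0 \<le> n}" "B \<in> {cylinder n t | n t. n0 \<le> n}"
  then obtain n t n' t' where AB: "A = cylinder n t" "n0 \<le> n" "B = cylinder n' t'" "n0 \<le> n'" by blast
  define u where "u m = (if m < n then if m < n' then min (t m) (t' m) else t m else t' m)" for m
  have "(\<forall>m<max n n'. s m < u m) \<longleftrightarrow> (\<forall>m<n. s m < t m) \<and> (\<forall>m<n'. s m < t' m)" for s :: "nat \<Rightarrow> real"
    unfolding u_def by (auto simp: less_max_iff_disj split: if_splits)
  then have "A \<inter> B = cylinder (max n n') u" unfolding AB cylinder_def by blast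
  then show "A \<inter> B \<in> {cylinder n t | n t. n0 \<le> n}" using AB by auto
qed

lemma ex_common_bound: "\<exists>T. \<forall>m<n. greedy_point (points \<omega>) m < real T"
proof -
  obtain T where T: "Max ((\<lambda>m. greedy_point (points \<omega>) m) ` {..n}) < real T"
    using reals_Archimedean2 by blast
  show ?thesis
  proof (intro exI[of _ T] allI impI)
    fix m assume "m < n"
    then have "greedy_point (points \<omega>) m \<le> Max ((\<lambda>m. greedy_point (points \<omega>) m) ` {..n})"
      by (intro Max_ge) auto
    then show "greedy_point (points \<omega>) m < real T" using T by linarith
  qed
qed

text \<open>
  A bound on a single star point is a union of cylinders whose other bounds tend to infinity.
\<close>

lemma star_algebra_generated_by_cylinders:
  "sets (star_algebra M X) \<subseteq> sigma_sets (space M) {cylinder n t | n t. n0 \<le> n}"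
proof -
  let ?G = "{cylinder n t | n t. n0 \<le> n}"
  define F where "F = sigma (space M) ?G"
  have sets_F: "sets F = sigma_sets (space M) ?G"
    unfolding F_def by (rule sets_measure_of) (auto simp: cylinder_def)
  have space_F: "space F = space M" by (simp add: F_def space_measure_of_conv)
  have meas: "(\<lambda>\<omega>. greedy_point (points \<omega>) m) \<in> borel_measurable F" for m
    unfolding borel_measurable_iff_less
  proof
    fix a
    let ?t = "\<lambda>T l. if l = m then a else real T"
    have "{\<omega>\<in>space F. greedy_point (points \<omega>) m < a} = (\<Union>T. cylinder (max n0 (Suc m)) (?t T))"
    proof (intro equalityI subsetI)
      fix \<omega> assume w: "\<omega> \<in> {\<omega>\<in>space F. greedy_point (points \<omega>) m < a}"
      obtain T where "\<forall>l<max n0 (Suc m). greedy_point (points \<omega>) l < real T"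
        using ex_common_bound by blast
      then have "\<omega> \<in> cylinder (max n0 (Suc m)) (?t T)"
        using w by (auto simp: cylinder_def space_F)
      then show "\<omega> \<in> (\<Union>T. cylinder (max n0 (Suc m)) (?t T))" by blast
    next
      fix \<omega> assume "\<omega> \<in> (\<Union>T. cylinder (max n0 (Suc m)) (?t T))"
      then obtain T where T: "\<omega> \<in> space M"
          "\<forall>l<max n0 (Suc m). greedy_point (points \<omega>) l < ?t T l"
        by (auto simp: cylinder_def)
      have "m < max n0 (Suc m)" by simp
      then have "greedy_point (points \<omega>) m < ?t T m" using T(2) by blast
      then show "\<omega> \<in> {\<omega>\<in>space F. greedy_point (points \<omega>) m < a}" using T by (simp add: space_F)
    qed
    moreover have "cylinder (max n0 (Suc m)) (?t T) \<in> sets F" for T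
      unfolding sets_F by (intro sigma_sets.Basic) (auto intro!: exI)
    ultimately show "{\<omega>\<in>space F. greedy_point (points \<omega>) m < a} \<in> sets F" by auto
  qed
  have "{(\<lambda>\<omega>. greedy_point (points \<omega>) m) -` B \<inter> space M | m B. B \<in> sets borel} \<subseteq> sets F"
    using measurable_sets[OF meas] by (auto simp: space_F)
  from sets.sigma_sets_subset[OF this] show ?thesis
    by (simp only: sets_star_algebra space_F sets_F)
qed

text \<open>
  Dynkin's argument. The whole space need not be a cylinder, but it is an increasing union of
  cylinders, which gives the identity needed for complements.
\<close>

lemma set_integral_no_edge:
  assumes w: "0 \<le> w" and n: "w < real n" and A: "A \<in> sets (star_algebra M X)"
  shows "(LINT \<omega>:A|M. indicator (no_edge_event M X w) \<omega>) = (LINT \<omega>:A|M. gap_weight w n \<omega>)"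
proof -
  let ?f = "indicator (no_edge_event M X w) :: 'a \<Rightarrow> real" and ?g = "gap_weight w n"
  let ?G = "{cylinder l t | l t. n \<le> l}"
  have f: "integrable M ?f" by (simp add: emeasure_eq_measure)
  have g: "integrable M ?g"
    by (rule integrable_const_bound[where B=1]) (use gap_weight_bounds in auto)
  have set_int: "set_integrable M B ?f" "set_integrable M B ?g" if "B \<in> events" for B
    using f g that unfolding set_integrable_def by (auto intro: integrable_mult_indicator simp del: real_scaleR_def)
  have wl: "w < real l" if "n \<le> l" for l using n that by linarith
  have cyl: "(LINT \<omega>:cylinder l t|M. ?f \<omega>) = (LINT \<omega>:cylinder l t|M. ?g \<omega>)" if "n \<le> l" for l t
  proof -
    have "AE \<omega> in M. gap_weight w l \<omega> = gap_weight w n \<omega>"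
      using AE_space
    proof eventually_elim
      case (elim \<omega>)
      then interpret point_sequence "\<lambda>i. X i \<omega>" by (rule point_sequence_path)
      show ?case using exponent_eq_gap_length_sum[OF n] exponent_eq_gap_length_sum[OF wl[OF that]]
        by (simp add: gap_weight_def star_point_eq)
    qed
    then have "(\<integral>\<omega>. indicator (cylinder l t) \<omega> * gap_weight w l \<omega> \<partial>M) =
        (\<integral>\<omega>. indicator (cylinder l t) \<omega> * gap_weight w n \<omega> \<partial>M)"
      by (intro integral_cong_AE) auto
    then show ?thesis
      using integral_cylinder_no_edge[OF w wl[OF that], of t]
      by (simp add: set_lebesgue_integral_def cylinder_def)
  qed
  have space: "(LINT \<omega>:space M|M. ?f \<omega>) = (LINT \<omega>:space M|M. ?g \<omega>)"
  proof -
    let ?C = "\<lambda>T. cylinder n (\<lambda>_. real T)"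
    have inc: "incseq ?C" unfolding incseq_def cylinder_def by force
    have UN: "(\<Union>T. ?C T) = space M" using ex_common_bound by (auto simp: cylinder_def)
    have "(\<lambda>T. LINT \<omega>:?C T|M. ?f \<omega>) \<longlonglongrightarrow> (LINT \<omega>:(\<Union>T. ?C T)|M. ?f \<omega>)"
      by (intro set_integral_cont_up inc set_int) auto
    moreover have "(\<lambda>T. LINT \<omega>:?C T|M. ?g \<omega>) \<longlonglongrightarrow> (LINT \<omega>:(\<Union>T. ?C T)|M. ?g \<omega>)"
      by (intro set_integral_cont_up inc set_int) auto
    ultimately show ?thesis unfolding UN cyl[OF order_refl] by (rule LIMSEQ_unique)
  qed
  have G_events: "?G \<subseteq> events" by auto
  have G_space: "?G \<subseteq> Pow (space M)" by (auto simp: cylinder_def)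
  have sig: "B \<in> events" if "B \<in> sigma_sets (space M) ?G" for B
    using sets.sigma_sets_subset[OF G_events] that by blast
  have "A \<in> sigma_sets (space M) ?G" using star_algebra_generated_by_cylinders A by blast
  from Int_stable_cylinders G_space this show ?thesis
  proof (induction rule: sigma_sets_induct_disjoint)
    case (basic B)
    then show ?case using cyl by blast
  next
    case empty
    show ?case by (simp add: set_lebesgue_integral_def)
  next
    case (compl B)
    have B: "B \<in> events" "space M - B \<in> events" using sig[OF compl(1)] by auto
    have split: "(LINT \<omega>:space M|M. h \<omega>) = (LINT \<omega>:B|M. h \<omega>) + (LINT \<omega>:space M - B|M. h \<omega>)"
      if "set_integrable M B h" "set_integrable M (space M - B) h" for h :: "'a \<Rightarrow> real"
    proof -
      have "B \<union> (space M - B) = space M" using sets.sets_into_space[OF B(1)] by blast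
      then show ?thesis using set_integral_Un[OF _ that] by simp
    qed
    show ?case using split[of ?f] split[of ?g] set_int[OF B(1)] set_int[OF B(2)] compl space by simp
  next
    case (union B)
    have B: "B i \<in> events" for i using union(2) sig by blast
    have disj: "B i \<inter> B j = {}" if "i \<noteq> j" for i j
      using union(1) that by (auto simp: disjoint_family_on_def)
    have "(LINT \<omega>:(\<Union>i. B i)|M. ?f \<omega>) = (\<Sum>i. LINT \<omega>:B i|M. ?f \<omega>)"
      by (rule lebesgue_integral_countable_add[OF B disj]) (auto intro!: set_int B)
    also have "\<dots> = (\<Sum>i. LINT \<omega>:B i|M. ?g \<omega>)" using union by simp
    also have "\<dots> = (LINT \<omega>:(\<Union>i. B i)|M. ?g \<omega>)"
      by (rule lebesgue_integral_countable_add[OF B disj, symmetric]) (auto intro!: set_int B)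
    finally show ?case .
  qed
qed

end

theorem theorem2:
  fixes M :: "'a measure" and lam w :: real and X :: "nat \<Rightarrow> 'a \<Rightarrow> real"
  assumes "prob_space M"
    and "lam > 0"
    and "homogeneous_poisson_process M lam X"
    and "w \<ge> 1"
  shows "AE \<omega> in M.
    real_cond_exp M (star_algebra M X) (indicator (no_edge_event M X w)) \<omega> =
      exp (- lam * (max (real (star_index (\<lambda>i. X i \<omega>) w) - 1) 0
                    + min (w - star_last (\<lambda>i. X i \<omega>) w) 1))"
proof -
  interpret poisson_points M lam X
    using assms by (simp add: poisson_points_def poisson_points_axioms_def)
  interpret finite_measure_subalgebra M "star_algebra M X"
    by standard (rule subalgebra_star_algebra)
  obtain n where n: "w < real n" using reals_Archimedean2 by blast
  have "AE \<omega> in M. real_cond_exp M (star_algebra M X) (indicator (no_edge_event M X w)) \<omega> =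
      gap_weight w n \<omega>"
  proof (rule real_cond_exp_charact)
    fix A assume "A \<in> sets (star_algebra M X)"
    then show "(LINT \<omega>:A|M. indicator (no_edge_event M X w) \<omega>) = (LINT \<omega>:A|M. gap_weight w n \<omega>)"
      using set_integral_no_edge n assms(4) by simp
  next
    show "integrable M (indicator (no_edge_event M X w) :: 'a \<Rightarrow> real)" by (simp add: emeasure_eq_measure)
    show "integrable M (gap_weight w n)"
      by (rule integrable_const_bound[where B=1]) (use gap_weight_bounds in auto)
    show "gap_weight w n \<in> borel_measurable (star_algebra M X)" by (rule gap_weight_star_measurable)
  qed
  with AE_space show ?thesis
  proof eventually_elim
    case (elim \<omega>)
    then interpret point_sequence "\<lambda>i. X i \<omega>" by (blast intro: point_sequence_path)
    show ?case using elim exponent_eq_gap_length_sum[OF n]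
      by (simp add: gap_weight_def star_point_eq)
  qed
qed

end
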